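(* Let $y\in\mathbb{R}^n$ be an opinion vector in an SBC or SBI system with bounds vector $r\in\mathbb{R}^n_{>0}$, and let the adjacency matrix $A(y)$ have canonical form $\overline{A}(y)=P(y)A(y)P^T(y)$ with blocks $C=C(y)$, $M=M(y)$, $\Theta=\Theta(y)$, $\Theta_C=\Theta_C(y)$, $\Theta_M=\Theta_M(y)$. Then: (i) $\operatorname{fvct}(y)$ is well defined, and is equal to $$\operatorname{fvct}(y)=P^T(y)\begin{bmatrix} C & 0 & 0\\ 0 & M^* & 0\\ (I-\Theta)^{-1}\Theta_C C & (I-\Theta)^{-1}\Theta_M M^* & 0\end{bmatrix}P(y)\,y,$$ where $M^*=M^*(y)=\lim_{t\to\infty}M(y)^t$, and this limit is well defined. (ii) If the two networks of agents with opinion vectors $y$ and $\operatorname{fvct}(y)$ have the same interconnection topology, i.e. $G_r(y)=G_r(\operatorname{fvct}(y))$, then (a) $\operatorname{fvct}(y)$ is an equilibrium opinion vector, (b) $G_r(y)$ contains no moderate-minded component, and (c) in any weakly connected component of $G_r(\operatorname{fvct}(y))$, the maximum and minimum opinions (entries of $\operatorname{fvct}(y)$) belong to its closed-minded components.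
   Context: There are $n$ agents with opinion vector $y\in\mathbb{R}^n$ and a fixed bounds vector $r\in\mathbb{R}^n_{>0}$. To $y$ one associates a proximity digraph $G_r(y)$ with nodes $\{1,\dots,n\}$, where the set of out-neighbors of node $i$ is: in the synchronized bounded confidence (SBC) case $\mathcal{N}_i(y)=\{j: |y_i-y_j|\le r_i\}$; in the synchronized bounded influence (SBI) case $\mathcal{N}_i(y)=\{j: |y_i-y_j|\le r_j\}$ (so $i\in\mathcal{N}_i(y)$ always). $G_r(y)$ denotes either of the two digraphs, the same choice throughout. The adjacency matrix $A(y)\in\mathbb{R}^{n\times n}$ has entries $a_{ij}(y)=1/|\mathcal{N}_i(y)|$ if $j\in\mathcal{N}_i(y)$ and $0$ otherwise. The SBC (resp. SBI) system is $x(t+1)=A(x(t))x(t)$. An opinion vector $y_0$ is an equilibrium opinion vector if $y_0=A(y_0)y_0$. The final value at constant topology of $y$ is $\operatorname{fvct}(y)=\lim_{t\to\infty}A(y)^t y$. The condensation digraph $C(G)$ of a digraph $G$ has as nodes the strongly connected components (SCCs) of $G$, with an edge from $H_1$ to $H_2$ ($H_1\ne H_2$) iff $G$ has an edge from a node of $H_1$ to a node of $H_2$; a sink is a node with out-degree zero. A weakly connected component (WCC) is a maximal subgraph that is connected when edge directions are ignored. An SCC of $G_r(y)$ that corresponds to a sink of $C(G_r(y))$ is called closed-minded if it is a complete subgraph (every node of it has an edge to every node of it) and moderate-minded if it is a non-complete subgraph. All remaining SCCs are called open-minded. The open-minded subgraph is what remains after removing the closed- and moderate-minded components and their edges; its WCCs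 are called open-minded WCCs. Canonical form: $P(y)$ is a permutation matrix that orders the agents so that closed-minded agents come first, then moderate-minded agents, then open-minded agents, and $$\overline{A}(y)=P(y)A(y)P^T(y)=\begin{bmatrix} C(y)&0&0\\0&M(y)&0\\ \Theta_C(y)&\Theta_M(y)&\Theta(y)\end{bmatrix},$$ with $C(y)$, $M(y)$, $\Theta(y)$ block diagonal: the diagonal blocks of $C(y)$ are the adjacency matrices of the closed-minded components (each equal to $\mathbf{1}\mathbf{1}^T/k$ with $k$ the component size), those of $M(y)$ are the adjacency matrices of the moderate-minded components, and each diagonal block of $\Theta(y)$ corresponds to one open-minded WCC (and is block lower triangular with respect to its SCCs). $\Theta_C(y)$ and $\Theta_M(y)$ collect the entries for edges from open-minded nodes to closed- and moderate-minded nodes, respectively. *)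

theory Defs
  imports Complex_Main "Graph_Theory.Graph_Theory" "Jordan_Normal_Form.Gauss_Jordan_Elimination"
begin

section \<open>Bounded confidence and bounded influence systems\<close>

datatype bounded_model = SBC | SBI

text \<open>Agents are numbered from 0, so the nodes are \<open>0, \<dots>, n - 1\<close> where \<open>n = dim_vec y\<close>.\<close>

definition out_nbrs :: "bounded_model \<Rightarrow> real vec \<Rightarrow> real vec \<Rightarrow> nat \<Rightarrow> nat set" where
  "out_nbrs k r y i =
     {j. j < dim_vec y \<and> \<bar>y $ i - y $ j\<bar> \<le> (case k of SBC \<Rightarrow> r $ i | SBI \<Rightarrow> r $ j)}"

definition prox_digraph :: "bounded_model \<Rightarrow> real vec \<Rightarrow> real vec \<Rightarrow> (nat, nat \<times> nat) pre_digraph" where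
  "prox_digraph k r y =
     with_proj \<lparr> pverts = {..<dim_vec y}, parcs = {(i, j). i < dim_vec y \<and> j \<in> out_nbrs k r y i} \<rparr>"

definition adj_mat :: "bounded_model \<Rightarrow> real vec \<Rightarrow> real vec \<Rightarrow> real mat" where
  "adj_mat k r y = mat (dim_vec y) (dim_vec y)
     (\<lambda>(i, j). if j \<in> out_nbrs k r y i then 1 / real (card (out_nbrs k r y i)) else 0)"

definition equilibrium :: "bounded_model \<Rightarrow> real vec \<Rightarrow> real vec \<Rightarrow> bool" where
  "equilibrium k r y \<longleftrightarrow> y = adj_mat k r y *\<^sub>v y"

section \<open>Limits of vectors and matrices\<close>

text \<open>The types of vectors and matrices carry no topology. All members of the sequence are required
  to have the dimensions of the limit, which makes the limit unique.\<close>

definition vec_tendsto :: "(nat \<Rightarrow> real vec) \<Rightarrow> real vec \<Rightarrow> bool" where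
  "vec_tendsto X v \<longleftrightarrow> (\<forall>t. dim_vec (X t) = dim_vec v) \<and>
     (\<forall>i<dim_vec v. (\<lambda>t. X t $ i) \<longlonglongrightarrow> v $ i)"

definition vec_convergent :: "(nat \<Rightarrow> real vec) \<Rightarrow> bool" where
  "vec_convergent X \<longleftrightarrow> (\<exists>v. vec_tendsto X v)"

definition vec_lim :: "(nat \<Rightarrow> real vec) \<Rightarrow> real vec" where
  "vec_lim X = (THE v. vec_tendsto X v)"

definition mat_tendsto :: "(nat \<Rightarrow> real mat) \<Rightarrow> real mat \<Rightarrow> bool" where
  "mat_tendsto X A \<longleftrightarrow> (\<forall>t. dim_row (X t) = dim_row A \<and> dim_col (X t) = dim_col A) \<and>
     (\<forall>i<dim_row A. \<forall>j<dim_col A. (\<lambda>t. X t $$ (i, j)) \<longlonglongrightarrow> A $$ (i, j))"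

definition mat_convergent :: "(nat \<Rightarrow> real mat) \<Rightarrow> bool" where
  "mat_convergent X \<longleftrightarrow> (\<exists>A. mat_tendsto X A)"

definition mat_lim :: "(nat \<Rightarrow> real mat) \<Rightarrow> real mat" where
  "mat_lim X = (THE A. mat_tendsto X A)"

definition fvct_seq :: "bounded_model \<Rightarrow> real vec \<Rightarrow> real vec \<Rightarrow> nat \<Rightarrow> real vec" where
  "fvct_seq k r y t = (adj_mat k r y ^\<^sub>m t) *\<^sub>v y"

definition fvct :: "bounded_model \<Rightarrow> real vec \<Rightarrow> real vec \<Rightarrow> real vec" where
  "fvct k r y = vec_lim (fvct_seq k r y)"

section \<open>Components of a digraph\<close>

definition condensation ::
    "('a, 'b) pre_digraph \<Rightarrow>
     (('a, 'b) pre_digraph, ('a, 'b) pre_digraph \<times> ('a, 'b) pre_digraph) pre_digraph" where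
  "condensation G = with_proj
     \<lparr> pverts = pre_digraph.sccs G,
       parcs = {(H1, H2). H1 \<in> pre_digraph.sccs G \<and> H2 \<in> pre_digraph.sccs G \<and> H1 \<noteq> H2 \<and>
                  (\<exists>u\<in>verts H1. \<exists>v\<in>verts H2. u \<rightarrow>\<^bsub>G\<^esub> v)} \<rparr>"

definition sink_sccs :: "('a, 'b) pre_digraph \<Rightarrow> ('a, 'b) pre_digraph set" where
  "sink_sccs G = {H \<in> verts (condensation G). out_degree (condensation G) H = 0}"

text \<open>Completeness includes the arc from each node to itself.\<close>

definition complete_subgraph :: "('a, 'b) pre_digraph \<Rightarrow> bool" where
  "complete_subgraph H \<longleftrightarrow> (\<forall>u\<in>verts H. \<forall>v\<in>verts H. u \<rightarrow>\<^bsub>H\<^esub> v)"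

definition closed_minded :: "('a, 'b) pre_digraph \<Rightarrow> ('a, 'b) pre_digraph set" where
  "closed_minded G = {H \<in> sink_sccs G. complete_subgraph H}"

definition moderate_minded :: "('a, 'b) pre_digraph \<Rightarrow> ('a, 'b) pre_digraph set" where
  "moderate_minded G = {H \<in> sink_sccs G. \<not> complete_subgraph H}"

definition open_minded :: "('a, 'b) pre_digraph \<Rightarrow> ('a, 'b) pre_digraph set" where
  "open_minded G = pre_digraph.sccs G - (closed_minded G \<union> moderate_minded G)"

definition open_minded_subgraph :: "('a, 'b) pre_digraph \<Rightarrow> ('a, 'b) pre_digraph" where
  "open_minded_subgraph G =
     G \<restriction> (verts G - \<Union> (verts ` (closed_minded G \<union> moderate_minded G)))"

text \<open>\<open>connected\<close> is connectedness of the underlying undirected graph.\<close>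

definition wccs :: "('a, 'b) pre_digraph \<Rightarrow> ('a, 'b) pre_digraph set" where
  "wccs G = {H. pre_digraph.max_subgraph G connected H}"

section \<open>Canonical form of the adjacency matrix\<close>

definition mat_select :: "'a mat \<Rightarrow> nat list \<Rightarrow> nat list \<Rightarrow> 'a mat" where
  "mat_select A is js = mat (length is) (length js) (\<lambda>(a, b). A $$ (is ! a, js ! b))"

text \<open>The permutation matrix that moves entry \<open>is ! a\<close> of a vector to position \<open>a\<close>.\<close>

definition order_mat :: "nat list \<Rightarrow> real mat" where
  "order_mat is = mat (length is) (length is) (\<lambda>(a, b). if b = is ! a then 1 else 0)"

text \<open>The block matrix with rows \<open>[C, 0, 0]\<close>, \<open>[0, M, 0]\<close> and \<open>[L1, L2, T]\<close>. The inner block matrix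
  in the third argument has no lower blocks: it is \<open>[L1, L2]\<close>.\<close>

definition canonical_block :: "real mat \<Rightarrow> real mat \<Rightarrow> real mat \<Rightarrow> real mat \<Rightarrow> real mat \<Rightarrow> real mat" where
  "canonical_block C M L1 L2 T =
     four_block_mat
       (four_block_mat C (0\<^sub>m (dim_row C) (dim_col M)) (0\<^sub>m (dim_row M) (dim_col C)) M)
       (0\<^sub>m (dim_row C + dim_row M) (dim_col T))
       (four_block_mat L1 L2 (0\<^sub>m 0 (dim_col L1)) (0\<^sub>m 0 (dim_col L2)))
       T"

text \<open>The order of the agents is given by lists: \<open>cs\<close> and \<open>ms\<close> enumerate the closed- and
  moderate-minded components, each as a list of its nodes, and \<open>ws\<close> enumerates the open-minded WCCs,
  each as a list of the SCCs it consists of. The \<open>sorted_wrt\<close> condition says that no arc leads from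
  an SCC to a later one in the same WCC, so that the corresponding block of \<open>Th\<close> is block lower
  triangular.\<close>

definition canonical_form ::
    "bounded_model \<Rightarrow> real vec \<Rightarrow> real vec \<Rightarrow>
     real mat \<Rightarrow> real mat \<Rightarrow> real mat \<Rightarrow> real mat \<Rightarrow> real mat \<Rightarrow> real mat \<Rightarrow> bool" where
  "canonical_form k r y P C M ThC ThM Th \<longleftrightarrow>
    (let G = prox_digraph k r y; A = adj_mat k r y in
     \<exists>(cs :: nat list list) (ms :: nat list list) (ws :: nat list list list).
       let order = concat cs @ concat ms @ concat (concat ws) in
       distinct order \<and> set order = {..<dim_vec y} \<and>
       set ` set cs = verts ` closed_minded G \<and>
       set ` set ms = verts ` moderate_minded G \<and>
       set ` set (concat ws) = verts ` open_minded G \<and>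
       (\<lambda>W. set (concat W)) ` set ws = verts ` wccs (open_minded_subgraph G) \<and>
       (\<forall>W\<in>set ws. sorted_wrt (\<lambda>l l'. \<forall>u\<in>set l. \<forall>v\<in>set l'. \<not> u \<rightarrow>\<^bsub>G\<^esub> v) W) \<and>
       P = order_mat order \<and>
       C = diag_block_mat (map (\<lambda>l. mat_select A l l) cs) \<and>
       M = diag_block_mat (map (\<lambda>l. mat_select A l l) ms) \<and>
       Th = diag_block_mat (map (\<lambda>W. mat_select A (concat W) (concat W)) ws) \<and>
       ThC = mat_select A (concat (concat ws)) (concat cs) \<and>
       ThM = mat_select A (concat (concat ws)) (concat ms) \<and>
       P * A * transpose_mat P = canonical_block C M ThC ThM Th)"

section \<open>Existence of the canonical form\<close>

text \<open>The predicate \<open>canonical_form\<close> can always be satisfied.\<close>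

lemma (in wf_digraph) wccs_verts_conv:
  "verts ` wccs G = pre_digraph.sccs_verts (with_proj (mk_symmetric G))"
proof -
  let ?Q = "with_proj (mk_symmetric G)"
  let ?S = "\<lambda>u. {v. u \<rightarrow>\<^sup>*\<^bsub>?Q\<^esub> v}"
  interpret Q: pair_wf_digraph "mk_symmetric G" ..
  have symQ: "v \<rightarrow>\<^sup>*\<^bsub>?Q\<^esub> u" if "u \<rightarrow>\<^sup>*\<^bsub>?Q\<^esub> v" for u v
    using symmetric_mk_symmetric that by (rule symmetric_reachable)
  have S_scc: "?S u \<in> Q.sccs_verts" if "u \<in> verts G" for u
    unfolding Q.in_sccs_verts_conv_reachable
  proof (intro conjI ballI allI impI)
    show "?S u \<noteq> {}" using that by (auto intro!: exI[of _ u] Q.reachable_refl)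
  qed (auto intro: Q.reachable_trans symQ)
  have S_verts: "?S u \<subseteq> verts G" for u
    using Q.reachable_in_verts by auto
  have S_conn: "connected (G \<restriction> ?S u)" if u: "u \<in> verts G" for u
  proof -
    interpret m: max_reachable_set ?Q "?S u"
      by unfold_locales (rule S_scc[OF u])
    have "with_proj (mk_symmetric (G \<restriction> ?S u)) = ?Q \<restriction> ?S u"
      unfolding mk_symmetric_def with_proj_def induce_subgraph_def by auto
    then show ?thesis
      unfolding connected_def using m.strongly_connected by simp
  qed
  have sub_S: "subgraph H (G \<restriction> ?S u) \<and> verts H \<subseteq> ?S u"
    if H: "subgraph H G" "connected H" "u \<in> verts H" for H u
  proof -
    have sg: "subgraph (mk_symmetric H) (mk_symmetric G)"
      using H(1) by (rule subgraph_mk_symmetric)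
    have vs: "verts H \<subseteq> ?S u"
    proof
      fix v assume "v \<in> verts H"
      then have "u \<rightarrow>\<^sup>*\<^bsub>mk_symmetric H\<^esub> v"
        using H unfolding connected_def strongly_connected_def by auto
      then show "v \<in> ?S u"
        using sg by (auto intro: pre_digraph.reachable_mono)
    qed
    have c: "tail G = tail H" "head G = head H" "wf_digraph H" "arcs H \<subseteq> arcs G"
      using H(1) by (auto simp: subgraph_def compatible_def)
    have "subgraph H (G \<restriction> ?S u)"
      using vs c by (auto simp: subgraph_def compatible_def wf_digraph.wellformed subset_iff)
    with vs show ?thesis by simp
  qed
  have S_wcc: "G \<restriction> ?S u \<in> wccs G" if u: "u \<in> verts G" for u
    unfolding wccs_def mem_Collect_eq
  proof (rule max_subgraphI)
    show "connected (G \<restriction> ?S u)" by (rule S_conn[OF u])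
    show "subgraph (G \<restriction> ?S u) G" using induced_induce[OF S_verts] by auto
    fix y assume y: "G \<restriction> ?S u \<noteq> y" "subgraph (G \<restriction> ?S u) y" "subgraph y G"
    show "\<not> connected y"
    proof
      assume "connected y"
      moreover have "u \<in> verts y"
        using y(2) u by (auto simp: subgraph_def)
      ultimately have "subgraph y (G \<restriction> ?S u)"
        using sub_S y(3) by blast
      with y(2) have "G \<restriction> ?S u = y"
        by (intro pre_digraph.equality) (auto simp: subgraph_def compatible_def)
      with y(1) show False by simp
    qed
  qed
  show ?thesis
  proof (intro equalityI subsetI)
    fix U assume "U \<in> verts ` wccs G"
    then obtain H where H: "max_subgraph connected H" "U = verts H"
      unfolding wccs_def by auto
    then have H': "subgraph H G" "connected H" by (auto simp: max_subgraph_def)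
    then obtain u where u: "u \<in> verts H"
      unfolding connected_def strongly_connected_def by auto
    with H' have uG: "u \<in> verts G" by (auto simp: subgraph_def)
    have "H = G \<restriction> ?S u"
      using H(1) S_wcc[OF uG] sub_S[OF H' u] unfolding wccs_def
      by (intro max_subgraph_subg_eq) auto
    then show "U \<in> Q.sccs_verts" using S_scc[OF uG] H(2) by simp
  next
    fix U assume U: "U \<in> Q.sccs_verts"
    then obtain u where u: "u \<in> U" unfolding Q.in_sccs_verts_conv_reachable by auto
    then have "U = ?S u"
      using U unfolding Q.in_sccs_verts_conv_reachable by (auto dest: symQ)
    moreover have "u \<in> verts G"
    proof -
      have "u \<rightarrow>\<^sup>*\<^bsub>?Q\<^esub> u" using u U by (simp add: Q.in_sccs_verts_conv_reachable)
      then show ?thesis using Q.reachable_in_verts(1) by fastforce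
    qed
    ultimately show "U \<in> verts ` wccs G"
      using S_wcc by (metis induce_subgraph_verts rev_image_eqI)
  qed
qed

lemma enum_sorted:
  fixes F :: "nat set set" and f :: "nat set \<Rightarrow> nat"
  assumes "finite F" "\<And>S. S \<in> F \<Longrightarrow> finite S" "\<And>S T. S \<in> F \<Longrightarrow> T \<in> F \<Longrightarrow> S \<noteq> T \<Longrightarrow> S \<inter> T = {}"
  shows "\<exists>ls. distinct (concat ls) \<and> set ` set ls = F \<and> sorted (map (\<lambda>l. f (set l)) ls)"
proof -
  obtain Fs where Fs: "set Fs = F" "distinct Fs" using finite_distinct_list[OF assms(1)] by blast
  define Gs where "Gs = sort_key f Fs"
  have Gs: "set Gs = F" "distinct Gs" "sorted (map f Gs)" using Fs by (auto simp: Gs_def)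
  define ls where "ls = map sorted_list_of_set Gs"
  have im: "set (sorted_list_of_set S) = S" if "S \<in> F" for S using assms(2)[OF that] by simp
  have "inj_on sorted_list_of_set F" using im by (metis inj_onI)
  then have d: "distinct ls" using Gs by (simp add: ls_def distinct_map)
  have "distinct (concat ls)"
  proof (rule distinct_concat[OF d])
    fix ys assume "ys \<in> set ls" then show "distinct ys" by (auto simp: ls_def)
  next
    fix ys zs assume "ys \<in> set ls" "zs \<in> set ls" "ys \<noteq> zs"
    then obtain S T where "ys = sorted_list_of_set S" "zs = sorted_list_of_set T" "S \<in> F" "T \<in> F" "S \<noteq> T"
      using Gs(1) by (auto simp: ls_def)
    then show "set ys \<inter> set zs = {}" using assms(3)[of S T] im by simp
  qed
  moreover have "set ` set ls = F" using im Gs(1) by (auto simp: ls_def image_iff)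
  moreover have "map (\<lambda>l. f (set l)) ls = map f Gs" using im Gs(1) by (auto simp: ls_def)
  ultimately show ?thesis using Gs(3) by metis
qed

lemma diag_block_mat_select:
  assumes "\<And>i j u v. i < length ls \<Longrightarrow> j < length ls \<Longrightarrow> i \<noteq> j \<Longrightarrow> u \<in> set (ls ! i) \<Longrightarrow> v \<in> set (ls ! j)
      \<Longrightarrow> A $$ (u, v) = 0"
  shows "diag_block_mat (map (\<lambda>l. mat_select A l l) ls) = mat_select A (concat ls) (concat ls)"
  using assms
proof (induction ls)
  case Nil
  then show ?case by (auto simp: mat_select_def)
next
  case (Cons l ls)
  have IH: "diag_block_mat (map (\<lambda>l. mat_select A l l) ls) = mat_select A (concat ls) (concat ls)"
  proof (rule Cons.IH)
    fix i j u v assume "i < length ls" "j < length ls" "i \<noteq> j" "u \<in> set (ls ! i)" "v \<in> set (ls ! j)"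
    then show "A $$ (u, v) = 0" using Cons.prems[of "Suc i" "Suc j" u v] by simp
  qed
  have z: "A $$ (u, v) = 0 \<and> A $$ (v, u) = 0" if uv: "u \<in> set l" "v \<in> set (concat ls)" for u v
  proof -
    obtain j where "j < length ls" "v \<in> set (ls ! j)" using uv(2) unfolding set_concat by (metis UN_E in_set_conv_nth)
    then show ?thesis using Cons.prems[of 0 "Suc j" u v] Cons.prems[of "Suc j" 0 v u] uv(1) by simp
  qed
  show ?case
    unfolding list.map diag_block_mat.simps IH Let_def
    by (rule eq_matI) (auto simp: mat_select_def nth_append z simp del: set_concat)
qed

lemma mat_select_append:
  "mat_select A (is @ is') (js @ js') =
    four_block_mat (mat_select A is js) (mat_select A is js') (mat_select A is' js) (mat_select A is' js')"
  by (rule eq_matI) (auto simp: mat_select_def nth_append)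

lemma order_mat_conj:
  assumes "A \<in> carrier_mat n n" "distinct is" "set is = {..<n}"
  shows "order_mat is * A * transpose_mat (order_mat is) = mat_select A is is"
proof -
  have len: "length is = n" using assms(2,3) by (metis card_lessThan distinct_card)
  have lt: "is ! a < n" if "a < n" for a using assms(3) len that nth_mem by blast
  have 1: "order_mat is * A = mat n n (\<lambda>(a, b). A $$ (is ! a, b))"
  proof (rule eq_matI)
    fix a b assume "a < dim_row (mat n n (\<lambda>(a, b). A $$ (is ! a, b)))" "b < dim_col (mat n n (\<lambda>(a, b). A $$ (is ! a, b)))"
    then have ab: "a < n" "b < n" by auto
    have "(order_mat is * A) $$ (a, b) = (\<Sum>c = 0..<n. (if c = is ! a then 1 else 0) * A $$ (c, b))"
      using ab len assms(1) by (auto simp: order_mat_def scalar_prod_def)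
    also have "\<dots> = (\<Sum>c = 0..<n. if c = is ! a then A $$ (c, b) else 0)"
      by (rule sum.cong) auto
    also have "\<dots> = A $$ (is ! a, b)" using lt[OF ab(1)] by (subst sum.delta) auto
    finally show "(order_mat is * A) $$ (a, b) = mat n n (\<lambda>(a, b). A $$ (is ! a, b)) $$ (a, b)"
      using ab by simp
  qed (use len assms(1) in \<open>auto simp: order_mat_def\<close>)
  show ?thesis
  proof (rule eq_matI)
    fix a b assume "a < dim_row (mat_select A is is)" "b < dim_col (mat_select A is is)"
    then have ab: "a < n" "b < n" by (auto simp: mat_select_def len)
    have "(order_mat is * A * transpose_mat (order_mat is)) $$ (a, b)
        = (\<Sum>c = 0..<n. A $$ (is ! a, c) * (if c = is ! b then 1 else 0))"
      unfolding 1 using ab len by (auto simp: order_mat_def scalar_prod_def)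
    also have "\<dots> = (\<Sum>c = 0..<n. if c = is ! b then A $$ (is ! a, c) else 0)"
      by (rule sum.cong) auto
    also have "\<dots> = A $$ (is ! a, is ! b)" using lt[OF ab(2)] by (subst sum.delta) auto
    finally show "(order_mat is * A * transpose_mat (order_mat is)) $$ (a, b) = mat_select A is is $$ (a, b)"
      using ab len by (simp add: mat_select_def)
  qed (auto simp: order_mat_def mat_select_def)
qed

lemma disjoint_blocks_idx:
  assumes "distinct (concat ls)" "i < length ls" "j < length ls" "i \<noteq> j"
  shows "set (ls ! i) \<inter> set (ls ! j) = {}"
  using assms
proof (induction ls arbitrary: i j)
  case (Cons l ls)
  have d: "distinct (concat ls)" "set l \<inter> set (concat ls) = {}" using Cons.prems(1) by auto
  have sub: "set (ls ! m) \<subseteq> set (concat ls)" if "m < length ls" for m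
    using nth_mem[OF that] by auto
  show ?case
  proof (cases i)
    case 0
    then obtain j' where "j = Suc j'" using Cons.prems(4) by (cases j) auto
    then show ?thesis using 0 d(2) sub[of j'] Cons.prems(3) by auto
  next
    case i: (Suc i')
    show ?thesis
    proof (cases j)
      case 0
      then show ?thesis using i d(2) sub[of i'] Cons.prems(2) by auto
    next
      case (Suc j')
      then show ?thesis using i Cons.IH[OF d(1), of i' j'] Cons.prems by simp
    qed
  qed
qed simp

theorem canonical_form_exists:
  "\<exists>P C M ThC ThM Th. canonical_form k r y P C M ThC ThM Th"
proof -
  define n where "n = dim_vec y"
  define G where "G = prox_digraph k r y"
  define A where "A = adj_mat k r y"
  have vG: "verts G = {..<n}" by (simp add: G_def prox_digraph_def n_def)
  have aG: "u \<rightarrow>\<^bsub>G\<^esub> v \<longleftrightarrow> u < n \<and> v \<in> out_nbrs k r y u" for u v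
    by (simp add: G_def prox_digraph_def n_def)
  have arcsG: "arcs G = {(i, j). i < n \<and> j \<in> out_nbrs k r y i}"
    by (simp add: G_def prox_digraph_def n_def)
  have thG: "tail G = fst" "head G = snd" by (simp_all add: G_def prox_digraph_def)
  have "finite (arcs G)"
    by (rule finite_subset[of _ "{..<n} \<times> {..<n}"]) (auto simp: arcsG out_nbrs_def n_def)
  interpret G: fin_digraph G
    by unfold_locales (use \<open>finite (arcs G)\<close> in \<open>auto simp: vG arcsG thG out_nbrs_def n_def\<close>)
  have A0: "A $$ (u, v) = 0" if "u < n" "v < n" "\<not> u \<rightarrow>\<^bsub>G\<^esub> v" for u v
    using that by (auto simp: A_def adj_mat_def aG n_def)
  have Ac: "A \<in> carrier_mat n n" by (simp add: A_def adj_mat_def n_def)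
  let ?cl = "verts ` closed_minded G" and ?mo = "verts ` moderate_minded G"
    and ?op = "verts ` open_minded G"
  define O' where "O' = open_minded_subgraph G"
  let ?wc = "verts ` wccs O'"
  have sink_sccs: "sink_sccs G \<subseteq> G.sccs" by (auto simp: sink_sccs_def condensation_def)
  have cl_sub: "closed_minded G \<union> moderate_minded G = sink_sccs G"
    by (auto simp: closed_minded_def moderate_minded_def)
  have finS: "finite G.sccs_verts"
    by (rule finite_subset[of _ "Pow {..<n}"])
       (auto simp: G.sccs_verts_conv G.sccs_def vG[symmetric])
  have finel: "finite S" if "S \<in> G.sccs_verts" for S
    using that by (auto simp: G.sccs_verts_conv G.sccs_def intro: finite_subset[OF _ G.finite_verts])
  have inj: "H = H'" if "H \<in> G.sccs" "H' \<in> G.sccs" "verts H \<inter> verts H' \<noteq> {}" for H H'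
  proof -
    have "verts H = verts H'" using that G.sccs_verts_disjoint G.sccs_verts_conv by blast
    then show ?thesis using that G.induce_eq_iff_induced G.in_sccs_imp_induced by metis
  qed
  have finC: "finite G.sccs" unfolding G.sccs_conv_sccs_verts using finS by simp
  have cover: "\<exists>H \<in> G.sccs. u \<in> verts H" if "u < n" for u
  proof -
    have "u \<in> G.scc_of u" using that vG by (simp add: G.scc_of_def)
    moreover have "G.scc_of u \<in> G.sccs_verts"
      unfolding G.in_sccs_verts_conv_reachable G.scc_of_def
      using that vG by (auto intro: G.reachable_trans)
    ultimately show ?thesis using G.sccs_verts_conv by auto
  qed
  have sub_n: "verts H \<subseteq> {..<n}" if "H \<in> G.sccs" for H using that by (auto simp: G.sccs_def vG[symmetric])
  have sink_out: "v \<in> verts H" if hv: "H \<in> sink_sccs G" "u \<in> verts H" "u \<rightarrow>\<^bsub>G\<^esub> v" for H u v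
  proof (rule ccontr)
    assume nv: "v \<notin> verts H"
    obtain H' where H': "H' \<in> G.sccs" "v \<in> verts H'" using cover G.adj_in_verts(2)[OF hv(3)] vG by auto
    have "(H, H') \<in> out_arcs (condensation G) H"
      using hv H' nv sink_sccs by (auto simp: out_arcs_def condensation_def)
    moreover have "finite (out_arcs (condensation G) H)"
      by (rule finite_subset[of _ "G.sccs \<times> G.sccs"]) (use finC in \<open>auto simp: out_arcs_def condensation_def\<close>)
    ultimately have "out_degree (condensation G) H \<noteq> 0" by (auto simp: out_degree_def)
    with hv(1) show False by (simp add: sink_sccs_def)
  qed
  have vO: "verts O' = \<Union> ?op"
  proof -
    have "verts O' = {..<n} - \<Union> (verts ` sink_sccs G)"
      by (simp add: O'_def open_minded_subgraph_def vG cl_sub)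
    also have "\<dots> = \<Union> (verts ` (G.sccs - sink_sccs G))"
    proof (intro equalityI subsetI)
      fix u assume u: "u \<in> {..<n} - \<Union> (verts ` sink_sccs G)"
      then obtain H where "H \<in> G.sccs" "u \<in> verts H" using cover by blast
      then show "u \<in> \<Union> (verts ` (G.sccs - sink_sccs G))" using u by blast
    next
      fix u assume "u \<in> \<Union> (verts ` (G.sccs - sink_sccs G))"
      then obtain H where H: "H \<in> G.sccs" "H \<notin> sink_sccs G" "u \<in> verts H" by blast
      have "u \<notin> verts H'" if H': "H' \<in> sink_sccs G" for H'
        using inj[OF H(1), of H'] H H' sink_sccs by blast
      then show "u \<in> {..<n} - \<Union> (verts ` sink_sccs G)" using H sub_n by blast
    qed
    finally show ?thesis by (simp add: open_minded_def cl_sub)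
  qed
  have O'_ind: "O' = G \<restriction> verts O'" by (simp add: O'_def open_minded_subgraph_def)
  have vO_n: "verts O' \<subseteq> {..<n}" by (auto simp: O'_def open_minded_subgraph_def vG)
  interpret OO: wf_digraph O' by (subst O'_ind) (rule G.wellformed_induce_subgraph)
  interpret Q: pair_wf_digraph "mk_symmetric O'" ..
  have aO: "u \<rightarrow>\<^bsub>O'\<^esub> v \<longleftrightarrow> u \<rightarrow>\<^bsub>G\<^esub> v \<and> u \<in> verts O' \<and> v \<in> verts O'" for u v
    by (subst O'_ind) (auto simp: arcs_ends_def arc_to_ends_def)
  have wc: "?wc = Q.sccs_verts" by (rule OO.wccs_verts_conv)
  have symQ: "v \<rightarrow>\<^sup>*\<^bsub>mk_symmetric O'\<^esub> u" if "u \<rightarrow>\<^sup>*\<^bsub>mk_symmetric O'\<^esub> v" for u v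
    using symmetric_mk_symmetric that by (rule symmetric_reachable)
  have wc_closed: "v \<in> U" if "U \<in> ?wc" "u \<in> U" "u \<rightarrow>\<^sup>*\<^bsub>O'\<^esub> v" for U u v
  proof -
    have "u \<rightarrow>\<^sup>*\<^bsub>mk_symmetric O'\<^esub> v" using that(3) by (rule OO.reachable_mk_symmetricI)
    then show ?thesis
      using that(1,2) symQ unfolding wc Q.in_sccs_verts_conv_reachable by blast
  qed
  have wc_cover: "\<exists>U\<in>?wc. u \<in> U" if "u \<in> verts O'" for u
  proof -
    let ?U = "{v. u \<rightarrow>\<^sup>*\<^bsub>mk_symmetric O'\<^esub> v}"
    have u: "u \<in> ?U" using that by (auto intro!: Q.reachable_refl)
    have "?U \<in> Q.sccs_verts" unfolding Q.in_sccs_verts_conv_reachable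
    proof (intro conjI ballI allI impI)
      show "?U \<noteq> {}" using u by blast
    qed (auto intro: Q.reachable_trans symQ)
    with u show ?thesis unfolding wc by blast
  qed
  have wc_sub: "U \<subseteq> verts O' \<and> U \<noteq> {}" if "U \<in> ?wc" for U
  proof -
    have "u \<in> verts O'" if u: "u \<in> U" for u
    proof -
      have "u \<rightarrow>\<^sup>*\<^bsub>mk_symmetric O'\<^esub> u"
        using u \<open>U \<in> ?wc\<close> by (simp add: wc Q.in_sccs_verts_conv_reachable)
      then show ?thesis using Q.reachable_in_verts(1) by fastforce
    qed
    moreover have "U \<noteq> {}" using that by (simp add: wc Q.in_sccs_verts_conv_reachable)
    ultimately show ?thesis by blast
  qed
  have wc_disj: "U \<inter> V = {}" if "U \<in> ?wc" "V \<in> ?wc" "U \<noteq> V" for U V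
    using that unfolding wc by (rule Q.sccs_verts_disjoint)
  have op_in: "S \<subseteq> U" if SU: "S \<in> ?op" "U \<in> ?wc" "S \<inter> U \<noteq> {}" for S U
  proof
    fix v assume v: "v \<in> S"
    obtain u where u: "u \<in> S" "u \<in> U" using SU(3) by auto
    have S: "S \<in> G.sccs_verts" using SU(1) by (auto simp: G.sccs_verts_conv open_minded_def)
    interpret m: max_reachable_set G S by unfold_locales (rule S)
    have "u \<rightarrow>\<^sup>*\<^bsub>G \<restriction> S\<^esub> v" using m.reachable_induced m.reach_in u(1) v by blast
    moreover have "S \<subseteq> verts O'" using SU(1) vO by auto
    ultimately have "u \<rightarrow>\<^sup>*\<^bsub>G \<restriction> verts O'\<^esub> v" by (rule G.reachable_induce_ss)
    then have "u \<rightarrow>\<^sup>*\<^bsub>O'\<^esub> v" using O'_ind by simp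
    then show "v \<in> U" using wc_closed SU(2) u(2) by blast
  qed

  have disj: "S \<inter> T = {}" if "S \<in> G.sccs_verts" "T \<in> G.sccs_verts" "S \<noteq> T" for S T
    using that by (rule G.sccs_verts_disjoint)
  have sv: "?cl \<subseteq> G.sccs_verts" "?mo \<subseteq> G.sccs_verts" "?op \<subseteq> G.sccs_verts"
    using sink_sccs by (auto simp: G.sccs_verts_conv closed_minded_def moderate_minded_def open_minded_def)

  obtain cs where cs: "distinct (concat cs)" "set ` set cs = ?cl"
    using enum_sorted[of ?cl "\<lambda>_. 0"] sv(1) finS finel disj by (metis (no_types, lifting) finite_subset subsetD)
  obtain ms where ms: "distinct (concat ms)" "set ` set ms = ?mo"
    using enum_sorted[of ?mo "\<lambda>_. 0"] sv(2) finS finel disj by (metis (no_types, lifting) finite_subset subsetD)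
  (* An arc from one SCC to another decreases the number of reachable nodes. *)
  define rk where "rk S = card (\<Union>u\<in>S. {v. u \<rightarrow>\<^sup>*\<^bsub>G\<^esub> v})" for S
  have rk: "rk T < rk S"
    if ST: "S \<in> G.sccs_verts" "T \<in> G.sccs_verts" "S \<noteq> T" "u \<in> S" "v \<in> T" "u \<rightarrow>\<^bsub>G\<^esub> v" for S T u v
  proof -
    interpret mS: max_reachable_set G S by unfold_locales (rule ST)
    interpret mT: max_reachable_set G T by unfold_locales (rule ST)
    let ?R = "\<lambda>S. \<Union>u\<in>S. {v. u \<rightarrow>\<^sup>*\<^bsub>G\<^esub> v}"
    have "u \<notin> T" using disj ST by blast
    have "?R T \<subseteq> ?R S"
    proof
      fix w assume "w \<in> ?R T"
      then obtain t where "t \<in> T" "t \<rightarrow>\<^sup>*\<^bsub>G\<^esub> w" by auto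
      then have "u \<rightarrow>\<^sup>*\<^bsub>G\<^esub> w"
        using mT.reach_in ST(5,6) G.reachable_trans G.adj_reachable_trans by blast
      then show "w \<in> ?R S" using ST(4) by auto
    qed
    moreover have "u \<in> ?R S" using ST mS.reach_in by blast
    moreover have "u \<notin> ?R T"
    proof
      assume "u \<in> ?R T"
      then obtain t where t: "t \<in> T" "t \<rightarrow>\<^sup>*\<^bsub>G\<^esub> u" by auto
      have "u \<rightarrow>\<^sup>*\<^bsub>G\<^esub> t" using ST(5,6) t(1) mT.reach_in G.adj_reachable_trans by blast
      then show False using t \<open>u \<notin> T\<close> mT.not_reach_out by blast
    qed
    moreover have "finite (?R S)"
      by (rule finite_subset[of _ "{..<n}"]) (auto simp: vG[symmetric] dest: G.reachable_in_verts)
    ultimately show ?thesis unfolding rk_def by (metis psubsetI psubset_card_mono)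
  qed
  have fin_wc: "finite ?wc" by (rule finite_subset[of _ "Pow {..<n}"]) (use wc_sub vO_n in auto)
  obtain Us where Us: "set Us = ?wc" "distinct Us" using finite_distinct_list[OF fin_wc] by blast
  have "\<exists>W. distinct (concat W) \<and> set ` set W = {S \<in> ?op. S \<subseteq> U} \<and> sorted (map (\<lambda>l. rk (set l)) W)" for U
  proof (rule enum_sorted)
    have X: "{S \<in> ?op. S \<subseteq> U} \<subseteq> G.sccs_verts" using sv(3) by blast
    show "finite {S \<in> ?op. S \<subseteq> U}" using X finS by (rule finite_subset)
    show "finite S" if "S \<in> {S \<in> ?op. S \<subseteq> U}" for S using finel[OF subsetD[OF X that]] .
    show "S \<inter> T = {}" if "S \<in> {S \<in> ?op. S \<subseteq> U}" "T \<in> {S \<in> ?op. S \<subseteq> U}" "S \<noteq> T" for S T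
      using disj[of S T] subsetD[OF X that(1)] subsetD[OF X that(2)] that(3) by blast
  qed
  then obtain f where f: "\<And>U. distinct (concat (f U))" "\<And>U. set ` set (f U) = {S \<in> ?op. S \<subseteq> U}"
    "\<And>U. sorted (map (\<lambda>l. rk (set l)) (f U))"
    by metis
  define ws where "ws = map f Us"
  have fU: "set (concat (f U)) = U" if UU: "U \<in> ?wc" for U
  proof -
    have "set (concat (f U)) = \<Union> (set ` set (f U))" by simp
    also have "\<dots> = \<Union> {S \<in> ?op. S \<subseteq> U}" unfolding f(2) ..
    also have "\<dots> = U"
    proof (intro equalityI subsetI)
      fix u assume u: "u \<in> U"
      then obtain S where "S \<in> ?op" "u \<in> S" using wc_sub[OF UU] vO by blast
      with u op_in[of S U] UU show "u \<in> \<Union> {S \<in> ?op. S \<subseteq> U}" by blast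
    qed auto
    finally show ?thesis .
  qed
  have ws_im: "(\<lambda>W. set (concat W)) ` set ws = ?wc"
    using fU Us(1) by (force simp: ws_def image_image simp del: set_concat)
  have ws_op: "set ` set (concat ws) = ?op"
  proof -
    have "set ` set (concat ws) = (\<Union>U\<in>?wc. set ` set (f U))" by (auto simp: ws_def Us(1))
    also have "\<dots> = (\<Union>U\<in>?wc. {S \<in> ?op. S \<subseteq> U})" unfolding f(2) ..
    also have "\<dots> = ?op"
    proof (intro equalityI subsetI)
      fix S assume S: "S \<in> ?op"
      then have "S \<noteq> {}" "S \<subseteq> verts O'" using sv(3) vO by (auto simp: G.in_sccs_verts_conv_reachable)
      then obtain U where "U \<in> ?wc" "S \<inter> U \<noteq> {}" using wc_cover by blast
      then show "S \<in> (\<Union>U\<in>?wc. {S \<in> ?op. S \<subseteq> U})" using op_in S by blast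
    qed auto
    finally show ?thesis .
  qed
  have cc: "concat (concat ws) = concat (map (\<lambda>U. concat (f U)) Us)"
    unfolding ws_def by (induction Us) simp_all
  have dws: "distinct (concat (map (\<lambda>U. concat (f U)) Us))"
  proof (rule distinct_concat)
    have "inj_on (\<lambda>U. concat (f U)) ?wc" using fU by (metis (no_types, lifting) inj_onI)
    then show "distinct (map (\<lambda>U. concat (f U)) Us)" using Us by (simp add: distinct_map)
    fix ys assume "ys \<in> set (map (\<lambda>U. concat (f U)) Us)" then show "distinct ys" using f(1) by auto
  next
    fix ys zs assume yz: "ys \<in> set (map (\<lambda>U. concat (f U)) Us)" "zs \<in> set (map (\<lambda>U. concat (f U)) Us)" "ys \<noteq> zs"
    then obtain U V where UV: "U \<in> ?wc" "V \<in> ?wc" "ys = concat (f U)" "zs = concat (f V)" using Us by auto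
    with yz(3) have "U \<noteq> V" by auto
    then show "set ys \<inter> set zs = {}" using wc_disj UV fU by metis
  qed
  have setcs: "set (concat cs) = \<Union> ?cl" using cs(2) by auto
  have setms: "set (concat ms) = \<Union> ?mo" using ms(2) by auto
  have setws: "set (concat (concat ws)) = \<Union> ?op" unfolding ws_op[symmetric] by auto
  define order where "order = concat cs @ concat ms @ concat (concat ws)"
  have part: "\<Union> ?cl \<inter> \<Union> ?mo = {}" "\<Union> ?cl \<inter> \<Union> ?op = {}" "\<Union> ?mo \<inter> \<Union> ?op = {}"
  proof -
    have *: "\<Union> (verts ` X) \<inter> \<Union> (verts ` Y) = {}" if "X \<subseteq> G.sccs" "Y \<subseteq> G.sccs" "X \<inter> Y = {}" for X Y
    proof (rule ccontr)
      assume "\<not> ?thesis"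
      then obtain H H' where HH: "H \<in> X" "H' \<in> Y" "verts H \<inter> verts H' \<noteq> {}" by blast
      then have "H = H'" using inj[of H H'] that(1,2) by blast
      then show False using HH that(3) by blast
    qed
    have sub: "closed_minded G \<subseteq> G.sccs" "moderate_minded G \<subseteq> G.sccs" "open_minded G \<subseteq> G.sccs"
      using sink_sccs by (auto simp: closed_minded_def moderate_minded_def open_minded_def)
    show "\<Union> ?cl \<inter> \<Union> ?mo = {}" by (rule *) (use sub in \<open>auto simp: closed_minded_def moderate_minded_def\<close>)
    show "\<Union> ?cl \<inter> \<Union> ?op = {}" by (rule *) (use sub in \<open>auto simp: open_minded_def\<close>)
    show "\<Union> ?mo \<inter> \<Union> ?op = {}" by (rule *) (use sub in \<open>auto simp: open_minded_def\<close>)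
  qed
  have d_order: "distinct order"
    using cs(1) ms(1) dws part unfolding order_def distinct_append set_append setcs setms setws cc[symmetric]
    by blast
  have s_order: "set order = {..<n}"
  proof -
    have "set order = \<Union> (verts ` (closed_minded G \<union> moderate_minded G \<union> open_minded G))"
      unfolding order_def set_append setcs setms setws by auto
    also have "closed_minded G \<union> moderate_minded G \<union> open_minded G = G.sccs"
      using sink_sccs by (auto simp: open_minded_def closed_minded_def moderate_minded_def)
    also have "\<Union> (verts ` G.sccs) = {..<n}" using cover sub_n by blast
    finally show ?thesis .
  qed
  have srt: "sorted_wrt (\<lambda>l l'. \<forall>u\<in>set l. \<forall>v\<in>set l'. \<not> u \<rightarrow>\<^bsub>G\<^esub> v) W" if WW: "W \<in> set ws" for W
  proof -
    obtain U where U: "W = f U" using WW by (auto simp: ws_def)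
    have mem: "set (W ! i) \<in> G.sccs_verts" if "i < length W" for i
    proof -
      have "set (W ! i) \<in> set ` set (f U)" using nth_mem[OF that] U by blast
      then have "set (W ! i) \<in> ?op" unfolding f(2) by simp
      then show ?thesis by (rule subsetD[OF sv(3)])
    qed
    show ?thesis unfolding sorted_wrt_iff_nth_less
    proof (intro allI impI ballI notI)
      fix i j u v assume ij: "i < j" "j < length W" and uv: "u \<in> set (W ! i)" "v \<in> set (W ! j)" "u \<rightarrow>\<^bsub>G\<^esub> v"
      have "set (W ! i) \<inter> set (W ! j) = {}"
        using disjoint_blocks_idx[of W i j] f(1)[of U] ij U by auto
      then have "set (W ! i) \<noteq> set (W ! j)" using uv by auto
      then have "rk (set (W ! j)) < rk (set (W ! i))" 
        using rk[OF mem mem _ uv] ij by simp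
      moreover have "rk (set (W ! i)) \<le> rk (set (W ! j))"
        using f(3)[of U] ij unfolding U[symmetric] by (auto simp: sorted_iff_nth_mono)
      ultimately show False by simp
    qed
  qed
  have zero_sink: "A $$ (u, v) = 0"
    if "H \<in> sink_sccs G" "u \<in> verts H" "v \<notin> verts H" "v < n" for H u v
    using that sink_out sink_sccs sub_n by (intro A0) (auto, blast)
  have Cd: "diag_block_mat (map (\<lambda>l. mat_select A l l) ls) = mat_select A (concat ls) (concat ls)"
    if ls: "distinct (concat ls)" "set ` set ls \<subseteq> verts ` sink_sccs G" for ls
  proof (rule diag_block_mat_select)
    fix i j u v assume a: "i < length ls" "j < length ls" "i \<noteq> j" "u \<in> set (ls ! i)" "v \<in> set (ls ! j)"
    obtain H where H: "H \<in> sink_sccs G" "set (ls ! i) = verts H" using ls(2) nth_mem[OF a(1)] by blast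
    obtain H' where H': "H' \<in> sink_sccs G" "set (ls ! j) = verts H'" using ls(2) nth_mem[OF a(2)] by blast
    have "v \<notin> verts H" using disjoint_blocks_idx[OF ls(1) a(1-3)] a(5) H by auto
    moreover have "v < n" using H' a(5) sink_sccs sub_n by auto
    ultimately show "A $$ (u, v) = 0" using zero_sink H a(4) by auto
  qed
  have clC: "diag_block_mat (map (\<lambda>l. mat_select A l l) cs) = mat_select A (concat cs) (concat cs)"
    by (rule Cd) (use cs in \<open>auto simp: closed_minded_def\<close>)
  have moC: "diag_block_mat (map (\<lambda>l. mat_select A l l) ms) = mat_select A (concat ms) (concat ms)"
    by (rule Cd) (use ms in \<open>auto simp: moderate_minded_def\<close>)
  have opC: "diag_block_mat (map (\<lambda>W. mat_select A (concat W) (concat W)) ws)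
      = mat_select A (concat (concat ws)) (concat (concat ws))"
  proof -
    have "diag_block_mat (map (\<lambda>l. mat_select A l l) (map (\<lambda>U. concat (f U)) Us)) =
      mat_select A (concat (map (\<lambda>U. concat (f U)) Us)) (concat (map (\<lambda>U. concat (f U)) Us))"
    proof (rule diag_block_mat_select)
      let ?ls = "map (\<lambda>U. concat (f U)) Us"
      fix i j u v assume a: "i < length ?ls" "j < length ?ls" "i \<noteq> j" "u \<in> set (?ls ! i)" "v \<in> set (?ls ! j)"
      have U: "Us ! i \<in> ?wc" "Us ! j \<in> ?wc" using a(1,2) Us(1)[symmetric] by auto
      have uv: "u \<in> Us ! i" "v \<in> Us ! j"
        using a(1,2,4,5) fU[OF U(1)] fU[OF U(2)] by (simp_all del: set_concat)
      have ne: "Us ! i \<noteq> Us ! j" using a(1-3) Us(2) by (simp add: nth_eq_iff_index_eq)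
      have vs: "u \<in> verts O'" "v \<in> verts O'" using uv U wc_sub by auto
      have "\<not> u \<rightarrow>\<^bsub>G\<^esub> v"
      proof
        assume "u \<rightarrow>\<^bsub>G\<^esub> v"
        then have "u \<rightarrow>\<^sup>*\<^bsub>O'\<^esub> v" using vs aO by (intro OO.reachable_adjI) simp
        then have "v \<in> Us ! i" using wc_closed U uv by blast
        then show False using wc_disj[OF U ne] uv by auto
      qed
      then show "A $$ (u, v) = 0" using A0 vs vO_n by auto
    qed
    then show ?thesis unfolding cc by (simp add: ws_def comp_def)
  qed
  let ?c = "concat cs" and ?m = "concat ms" and ?o = "concat (concat ws)"
  have z: "mat_select A ?c ?m = 0\<^sub>m (length ?c) (length ?m)" "mat_select A ?c ?o = 0\<^sub>m (length ?c) (length ?o)"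
    "mat_select A ?m ?c = 0\<^sub>m (length ?m) (length ?c)" "mat_select A ?m ?o = 0\<^sub>m (length ?m) (length ?o)"
  proof -
    have *: "mat_select A is js = 0\<^sub>m (length is) (length js)"
      if X: "set is \<subseteq> \<Union> (verts ` X)" "X \<subseteq> sink_sccs G" "set js \<subseteq> {..<n}" "\<Union> (verts ` X) \<inter> set js = {}" for "is" js X
    proof (rule eq_matI)
      fix a b assume ab: "a < dim_row (0\<^sub>m (length is) (length js))" "b < dim_col (0\<^sub>m (length is) (length js))"
      then have m: "is ! a \<in> set is" "js ! b \<in> set js" by auto
      then obtain H where "H \<in> X" "is ! a \<in> verts H" using X(1) by auto
      then have "A $$ (is ! a, js ! b) = 0" using zero_sink[of H "is ! a" "js ! b"] X m(2) by blast
      then show "mat_select A is js $$ (a, b) = 0\<^sub>m (length is) (length js) $$ (a, b)"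
        using ab by (simp add: mat_select_def)
    qed (auto simp: mat_select_def)
    have n: "set ?c \<subseteq> {..<n}" "set ?m \<subseteq> {..<n}" "set ?o \<subseteq> {..<n}" using s_order by (auto simp: order_def)
    have p: "\<Union> ?cl \<inter> set ?m = {}" "\<Union> ?cl \<inter> set ?o = {}" "\<Union> ?mo \<inter> set ?c = {}" "\<Union> ?mo \<inter> set ?o = {}"
      using part unfolding setcs setms setws by blast+
    have X: "closed_minded G \<subseteq> sink_sccs G" "moderate_minded G \<subseteq> sink_sccs G" using cl_sub by auto
    show "mat_select A ?c ?m = 0\<^sub>m (length ?c) (length ?m)" "mat_select A ?c ?o = 0\<^sub>m (length ?c) (length ?o)"
      by (rule *[OF equalityD1[OF setcs] X(1)]; fact n p)+
    show "mat_select A ?m ?c = 0\<^sub>m (length ?m) (length ?c)" "mat_select A ?m ?o = 0\<^sub>m (length ?m) (length ?o)"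
      by (rule *[OF equalityD1[OF setms] X(2)]; fact n p)+
  qed
  have dims: "dim_row (mat_select A is js) = length is" "dim_col (mat_select A is js) = length js" for "is" js
    by (simp_all add: mat_select_def)
  have eqn: "order_mat order * A * transpose_mat (order_mat order) =
      canonical_block (mat_select A ?c ?c) (mat_select A ?m ?m) (mat_select A ?o ?c) (mat_select A ?o ?m)
        (mat_select A ?o ?o)"
  proof -
    have "mat_select A order order = canonical_block (mat_select A ?c ?c) (mat_select A ?m ?m) (mat_select A ?o ?c) (mat_select A ?o ?m)
        (mat_select A ?o ?o)"
      unfolding canonical_block_def dims z[symmetric]
        order_def append_assoc[symmetric] mat_select_append[of A "?c @ ?m" ?o]
    proof (rule cong_four_block_mat)
      show "mat_select A (?c @ ?m) (?c @ ?m) = four_block_mat (mat_select A ?c ?c) (mat_select A ?c ?m) (mat_select A ?m ?c) (mat_select A ?m ?m)"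
        by (rule mat_select_append)
      show "mat_select A (?c @ ?m) ?o = 0\<^sub>m (length ?c + length ?m) (length ?o)"
      proof (rule eq_matI)
        fix a b assume ab: "a < dim_row (0\<^sub>m (length ?c + length ?m) (length ?o))" "b < dim_col (0\<^sub>m (length ?c + length ?m) (length ?o))"
        have ab': "a < length ?c + length ?m" "b < length ?o" using ab by (simp_all only: index_zero_mat)
        have 1: "A $$ (?c ! a, ?o ! b) = 0" if "a < length ?c"
        proof -
          have "mat_select A ?c ?o $$ (a, b) = 0" unfolding z(2) using that ab' by (simp only: index_zero_mat)
          then show ?thesis using that ab' by (simp add: mat_select_def del: length_concat)
        qed
        have 2: "A $$ (?m ! (a - length ?c), ?o ! b) = 0" if "\<not> a < length ?c"
        proof -
          have "a - length ?c < length ?m" using that ab' by linarith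
          then have "mat_select A ?m ?o $$ (a - length ?c, b) = 0" unfolding z(4) using ab' by (simp only: index_zero_mat)
          then show ?thesis using \<open>a - length ?c < length ?m\<close> ab' by (simp add: mat_select_def del: length_concat)
        qed
        show "mat_select A (?c @ ?m) ?o $$ (a, b) = 0\<^sub>m (length ?c + length ?m) (length ?o) $$ (a, b)"
          using ab' 1 2 by (cases "a < length ?c") (simp_all add: mat_select_def nth_append del: length_concat)
      qed (simp_all add: mat_select_def)
      show "mat_select A ?o (?c @ ?m) = four_block_mat (mat_select A ?o ?c) (mat_select A ?o ?m) (0\<^sub>m 0 (length ?c)) (0\<^sub>m 0 (length ?m))"
        by (rule eq_matI) (auto simp: mat_select_def nth_append simp del: length_concat)
    qed simp
    then show ?thesis using order_mat_conj[OF Ac d_order s_order] by simp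
  qed
  show ?thesis
    unfolding canonical_form_def Let_def G_def[symmetric] A_def[symmetric] n_def[symmetric] O'_def[symmetric]
    by (rule exI[of _ "order_mat order"], rule exI[of _ "mat_select A ?c ?c"],
        rule exI[of _ "mat_select A ?m ?m"], rule exI[of _ "mat_select A ?o ?c"],
        rule exI[of _ "mat_select A ?o ?m"], rule exI[of _ "mat_select A ?o ?o"],
        rule exI[of _ cs], rule exI[of _ ms], rule exI[of _ ws], fold order_def)
       (intro conjI ballI d_order s_order cs(2) ms(2) ws_op ws_im srt eqn refl
          clC[symmetric] moC[symmetric] opC[symmetric]; assumption)
qed

end

theory Submission
  imports "Jordan_Normal_Form.Determinant" Defs
begin

text \<open>The adjacency matrix \<open>A\<close> replaces each opinion by an average of opinions in which, because the
  bounds are positive, the agent's own opinion has positive weight. Two facts about such averaging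
  carry the proof.

  The first is that all orbits \<open>A ^\<^sub>m t *\<^sub>v x\<close> converge (\<open>convergent_orbit\<close>), although \<open>A\<close> need not be
  irreducible. The positive self-weights exclude periodic behaviour: an entry approaches an upper
  bound of all entries only gradually, and seen backwards in time this makes the increments of a
  bounded orbit tend to zero. An accumulation point of the orbit is then a fixed point of \<open>A\<close>, and
  the orbit converges to it because averaging does not increase the distance to a fixed point.
  Applied to the unit vectors this gives a limit \<open>A_lim\<close> of the powers of \<open>A\<close>, whose columns are fixed
  by \<open>A\<close>.

  The second is a maximum principle (\<open>maximum_principle\<close>): if \<open>u\<close> is fixed by \<open>A\<close> and is largest
  at \<open>i\<close> among the nodes that \<open>i\<close> reaches, then \<open>u\<close> is constant on these nodes. Since every node
  reaches a sink of the condensation digraph, a fixed vector that vanishes on the sinks is zero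
  (\<open>harmonic_zero\<close>).

  The block form of \<open>A_lim\<close> follows. No weight leaves a sink, which gives the zero blocks in the rows
  of the closed- and moderate-minded agents. A closed-minded block is idempotent, so it is its own
  limit. The columns of \<open>A_lim\<close> for open-minded agents vanish on the sinks, hence they are zero. The
  same principle shows that \<open>1 - \<Theta>\<close> is injective, so the equation \<open>A * A_lim = A_lim\<close> can be solved for
  the two lower blocks.

  If \<open>y\<close> and \<open>z = fvct y\<close> have the same digraph, then they have the same adjacency matrix, and \<open>z\<close>
  is fixed by it. The remaining claims hold for every equilibrium \<open>z\<close>. By the maximum principle it
  is constant on each sink. Agents with equal opinions are joined by arcs in both directions, so each
  sink is complete. An extremal opinion of a weakly connected component is shared by a sink that
  the agent reaches, so the agent has an arc from that sink and belongs to it.\<close>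

section \<open>Iterated averaging with positive self-weights\<close>

locale lazy_averaging =
  fixes I :: "'i set" and a :: "'i \<Rightarrow> 'i \<Rightarrow> real"
  assumes finite_I: "finite I"
    and nonneg: "i \<in> I \<Longrightarrow> j \<in> I \<Longrightarrow> 0 \<le> a i j"
    and row_sum: "i \<in> I \<Longrightarrow> (\<Sum>j\<in>I. a i j) = 1"
    and self_pos: "i \<in> I \<Longrightarrow> 0 < a i i"
begin

lemma average_const: "i \<in> I \<Longrightarrow> (\<Sum>j\<in>I. a i j * B) = B"
  by (simp add: sum_distrib_right[symmetric] row_sum)

lemma average_le:
  assumes "i \<in> I" "\<And>j. j \<in> I \<Longrightarrow> x j \<le> B"
  shows "(\<Sum>j\<in>I. a i j * x j) \<le> B"
proof -
  have "(\<Sum>j\<in>I. a i j * x j) \<le> (\<Sum>j\<in>I. a i j * B)"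
    by (intro sum_mono mult_left_mono) (use assms nonneg in auto)
  then show ?thesis by (simp add: average_const assms)
qed

lemma average_abs_le:
  assumes "i \<in> I" "\<And>j. j \<in> I \<Longrightarrow> \<bar>x j\<bar> \<le> B"
  shows "\<bar>\<Sum>j\<in>I. a i j * x j\<bar> \<le> B"
proof -
  have "(\<Sum>j\<in>I. a i j * - x j) \<le> B"
    by (rule average_le) (use assms in \<open>auto simp: abs_le_iff\<close>)
  moreover have "(\<Sum>j\<in>I. a i j * x j) \<le> B"
    by (rule average_le) (use assms in \<open>auto simp: abs_le_iff\<close>)
  ultimately show ?thesis by (simp add: sum_negf abs_le_iff)
qed

text \<open>The weight \<open>a i i\<close> alone keeps entry \<open>i\<close> from closing its gap to a common upper bound in a
  single step; this is where the positive self-weights enter the convergence proof.\<close>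

lemma average_gap:
  assumes i: "i \<in> I" and x: "\<And>j. j \<in> I \<Longrightarrow> x j \<le> B" and \<delta>: "\<delta> \<le> a i i"
  shows "\<delta> * (B - x i) \<le> B - (\<Sum>j\<in>I. a i j * x j)"
proof -
  have "\<delta> * (B - x i) \<le> a i i * (B - x i)"
    using x[OF i] \<delta> by (intro mult_right_mono) auto
  also have "\<dots> \<le> (\<Sum>j\<in>I. a i j * (B - x j))"
    by (rule member_le_sum) (use i x nonneg finite_I in \<open>auto intro!: mult_nonneg_nonneg\<close>)
  also have "\<dots> = B - (\<Sum>j\<in>I. a i j * x j)"
    by (simp add: right_diff_distrib sum_subtractf average_const i)
  finally show ?thesis .
qed

lemma self_weight_bound:
  obtains \<delta> where "0 < \<delta>" "\<delta> \<le> 1" "\<And>i. i \<in> I \<Longrightarrow> \<delta> \<le> a i i"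
proof
  let ?\<delta> = "Min (insert 1 ((\<lambda>i. a i i) ` I))"
  show "0 < ?\<delta>" using finite_I self_pos by (subst Min_gr_iff) auto
  show "?\<delta> \<le> 1" "\<And>i. i \<in> I \<Longrightarrow> ?\<delta> \<le> a i i" using finite_I by auto
qed

text \<open>The largest entry is nonincreasing in time; let \<open>m\<close> be its limit. The distance of an entry to an
  upper bound of all entries shrinks in one step at most by a fixed factor. Hence an entry that is
  at least \<open>m\<close> at a late time has been close to \<open>m\<close> or above it during a long period before. If \<open>m\<close> were
  positive, the partial sums would be unbounded.\<close>

lemma eventually_le_if_bounded_sums:
  assumes step: "\<And>t i. i \<in> I \<Longrightarrow> v (Suc t) i = (\<Sum>j\<in>I. a i j * v t j)"
    and bounded: "\<And>t i. i \<in> I \<Longrightarrow> \<bar>\<Sum>s<t. v s i\<bar> \<le> K"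
    and "0 < e"
  shows "\<forall>\<^sub>F t in sequentially. \<forall>i\<in>I. v t i \<le> e"
proof (rule ccontr)
  assume contra: "\<not> ?thesis"
  have keep: "\<forall>i\<in>I. v t' i \<le> B" if "t \<le> t'" "\<forall>i\<in>I. v t i \<le> B" for t t' B
    using that by (induction rule: dec_induct) (auto simp: step intro!: average_le)
  have big: "\<exists>i\<in>I. e < v t i" for t
  proof (rule ccontr)
    assume "\<not> ?thesis"
    then have "\<forall>i\<in>I. v t i \<le> e" by auto
    then have "\<forall>t'\<ge>t. \<forall>i\<in>I. v t' i \<le> e" using keep by blast
    then have "\<forall>\<^sub>F t in sequentially. \<forall>i\<in>I. v t i \<le> e"
      unfolding eventually_sequentially by blast
    with contra show False by simp
  qed
  define m where "m = Inf {B. \<exists>t. \<forall>i\<in>I. v t i \<le> B}"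
  have lower: "e \<le> B" if "\<forall>i\<in>I. v t i \<le> B" for t B
    using big[of t] that by force
  have bdd: "bdd_below {B. \<exists>t. \<forall>i\<in>I. v t i \<le> B}"
    by (rule bdd_belowI[of _ e]) (use lower in auto)
  have ne: "I \<noteq> {}" using big by auto
  have max_in: "Max (v t ` I) \<in> {B. \<exists>t. \<forall>i\<in>I. v t i \<le> B}" for t
    using finite_I by (auto intro!: exI[of _ t])
  have "e \<le> m"
    unfolding m_def by (rule cInf_greatest) (use max_in lower in blast)+
  then have "0 < m" using \<open>0 < e\<close> by simp
  have attained: "\<exists>i\<in>I. m \<le> v t i" for t
  proof -
    have "m \<le> Max (v t ` I)" unfolding m_def by (rule cInf_lower[OF max_in bdd])
    moreover have "Max (v t ` I) \<in> v t ` I" using finite_I ne by (intro Max_in) auto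
    ultimately show ?thesis by auto
  qed
  obtain \<delta> where \<delta>: "0 < \<delta>" "\<delta> \<le> 1" "\<And>i. i \<in> I \<Longrightarrow> \<delta> \<le> a i i"
    using self_weight_bound by blast
  \<comment> \<open>\<open>N\<close> values of at least \<open>m / 2\<close> are too much for the difference of two partial sums.\<close>
  obtain N :: nat where N: "2 * K < real N * (m / 2)"
    using reals_Archimedean3[of "m / 2"] half_gt_zero[OF \<open>0 < m\<close>] by blast
  \<comment> \<open>Gaps to the bound \<open>B\<close> grow at most by a factor \<open>1 / \<delta>\<close> per step backwards in time.\<close>
  define B where "B = m + m / 2 * \<delta> ^ N"
  have "m < B" using \<open>0 < m\<close> \<delta> by (simp add: B_def)
  then obtain B' T where "B' < B" "\<forall>i\<in>I. v T i \<le> B'"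
    using cInf_lessD[of "{B. \<exists>t. \<forall>i\<in>I. v t i \<le> B}" B] max_in unfolding m_def by blast
  then have le_B: "\<forall>i\<in>I. v (T + s) i \<le> B" for s
    using keep[of T "T + s" B'] by force
  obtain i where i: "i \<in> I" "m \<le> v (T + N) i" using attained by blast
  have gap: "\<delta> ^ d * (B - v (T + s) i) \<le> B - v (T + s + d) i" for s d
  proof (induction d)
    case (Suc d)
    have "\<delta> ^ Suc d * (B - v (T + s) i) \<le> \<delta> * (B - v (T + s + d) i)"
      using Suc.IH \<delta> by (simp add: mult.assoc)
    also have "\<dots> \<le> B - v (T + s + Suc d) i"
      using average_gap[of i "v (T + s + d)" B \<delta>] le_B[of "s + d"] \<delta>(3) i(1) step[OF i(1), of "T + s + d"]
      by (simp add: add.assoc)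
    finally show ?case .
  qed simp
  have "m / 2 \<le> v (T + s) i" if "s \<in> {..<N}" for s
  proof -
    have "\<delta> ^ N * (B - v (T + s) i) \<le> \<delta> ^ (N - s) * (B - v (T + s) i)"
      using le_B[of s] i(1) \<delta> by (intro mult_right_mono power_decreasing) auto
    also have "\<dots> \<le> B - v (T + N) i" using gap[where s=s and d="N - s"] that by simp
    also have "\<dots> \<le> \<delta> ^ N * (m / 2)" using i(2) by (simp add: B_def)
    finally have "B - v (T + s) i \<le> m / 2" using \<delta> by simp
    then show ?thesis using \<open>m < B\<close> by simp
  qed
  then have "real N * (m / 2) \<le> (\<Sum>s<N. v (T + s) i)"
    using sum_bounded_below[of "{..<N}" "m / 2" "\<lambda>s. v (T + s) i"] by simp
  also have "\<dots> = (\<Sum>s<T + N. v s i) - (\<Sum>s<T. v s i)"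
    by (induction N) simp_all
  also have "\<dots> \<le> 2 * K" using bounded[OF i(1), of "T + N"] bounded[OF i(1), of T] by linarith
  finally show False using N by simp
qed

lemma tendsto_0_if_bounded_sums:
  assumes step: "\<And>t i. i \<in> I \<Longrightarrow> v (Suc t) i = (\<Sum>j\<in>I. a i j * v t j)"
    and bounded: "\<And>t i. i \<in> I \<Longrightarrow> \<bar>\<Sum>s<t. v s i\<bar> \<le> K"
    and i: "i \<in> I"
  shows "(\<lambda>t. v t i) \<longlonglongrightarrow> 0"
proof (rule tendstoI)
  fix e :: real assume "0 < e"
  then have "0 < e / 2" by simp
  have "\<forall>\<^sub>F t in sequentially. \<forall>i\<in>I. v t i \<le> e / 2"
    using eventually_le_if_bounded_sums[OF step bounded \<open>0 < e / 2\<close>] .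
  moreover have "\<forall>\<^sub>F t in sequentially. \<forall>i\<in>I. - v t i \<le> e / 2"
    by (rule eventually_le_if_bounded_sums[of "\<lambda>t i. - v t i" K])
      (use step bounded \<open>0 < e\<close> in \<open>auto simp: sum_negf\<close>)
  ultimately show "\<forall>\<^sub>F t in sequentially. dist (v t i) 0 < e"
  proof eventually_elim
    case (elim t)
    then have "v t i \<le> e / 2" "- v t i \<le> e / 2" using i by auto
    then show ?case using \<open>0 < e\<close> by (auto simp: dist_real_def)
  qed
qed

end

lemma common_convergent_subsequence:
  fixes f :: "nat \<Rightarrow> 'i \<Rightarrow> real"
  assumes "finite I" "\<And>i. i \<in> I \<Longrightarrow> Bseq (\<lambda>t. f t i)"
  shows "\<exists>r. strict_mono r \<and> (\<forall>i\<in>I. convergent (\<lambda>t. f (r t) i))"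
  using assms
proof (induction I)
  case empty
  show ?case by (auto intro: strict_mono_id)
next
  case (insert i I)
  then obtain r where r: "strict_mono r" "\<forall>i\<in>I. convergent (\<lambda>t. f (r t) i)" by auto
  obtain s where s: "strict_mono s" "monoseq (\<lambda>t. f (r (s t)) i)"
    using seq_monosub[of "\<lambda>t. f (r t) i"] by auto
  have rs: "strict_mono (\<lambda>t. r (s t))" using r(1) s(1) by (simp add: strict_mono_def)
  have "Bseq (\<lambda>t. f (r (s t)) i)"
    using Bseq_subseq[of "\<lambda>t. f t i"] insert.prems by auto
  then have "convergent (\<lambda>t. f (r (s t)) i)" using s(2) by (rule Bseq_monoseq_convergent)
  moreover have "convergent (\<lambda>t. f (r (s t)) j)" if "j \<in> I" for j
    using convergent_subseq_convergent[of "\<lambda>t. f (r t) j" s] r(2) s(1) that by (simp add: comp_def)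
  ultimately show ?case using rs by auto
qed

context lazy_averaging
begin

text \<open>The increments of the orbit are themselves an orbit, with bounded partial sums because they
  telescope, so they vanish in the limit. Hence every accumulation point of the orbit is a fixed
  point, and the distance of the orbit to a fixed point does not increase.\<close>

theorem convergent_orbit:
  assumes step: "\<And>t i. i \<in> I \<Longrightarrow> x (Suc t) i = (\<Sum>j\<in>I. a i j * x t j)"
    and i: "i \<in> I"
  shows "convergent (\<lambda>t. x t i)"
proof -
  define K where "K = (\<Sum>j\<in>I. \<bar>x 0 j\<bar>)"
  have bounded: "\<forall>j\<in>I. \<bar>x t j\<bar> \<le> K" for t
  proof (induction t)
    case 0
    show ?case unfolding K_def using member_le_sum[of _ I "\<lambda>j. \<bar>x 0 j\<bar>"] finite_I by auto
  next
    case (Suc t)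
    then show ?case by (auto simp: step intro: average_abs_le)
  qed
  have increment: "(\<lambda>t. x (Suc t) j - x t j) \<longlonglongrightarrow> 0" if j: "j \<in> I" for j
  proof (rule tendsto_0_if_bounded_sums[where v = "\<lambda>t j. x (Suc t) j - x t j" and K = "2 * K", OF _ _ j])
    fix t l assume l: "l \<in> I"
    show "x (Suc (Suc t)) l - x (Suc t) l = (\<Sum>j\<in>I. a l j * (x (Suc t) j - x t j))"
      by (simp only: step[OF l] right_diff_distrib sum_subtractf)
    have "(\<Sum>s<t. x (Suc s) l - x s l) = x t l - x 0 l"
      using sum_lessThan_telescope[of "\<lambda>s. x s l" t] .
    then show "\<bar>\<Sum>s<t. x (Suc s) l - x s l\<bar> \<le> 2 * K"
      using bounded[of t] bounded[of 0] l by force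
  qed
  have "Bseq (\<lambda>t. x t j)" if "j \<in> I" for j
    using bounded that by (intro BseqI'[of _ K]) auto
  then obtain r where r: "strict_mono r" "\<forall>j\<in>I. convergent (\<lambda>t. x (r t) j)"
    using common_convergent_subsequence[OF finite_I] by metis
  define u where "u j = lim (\<lambda>t. x (r t) j)" for j
  have u: "(\<lambda>t. x (r t) j) \<longlonglongrightarrow> u j" if "j \<in> I" for j
    using r(2) that by (simp add: u_def convergent_LIMSEQ_iff)
  have fixed: "u j = (\<Sum>l\<in>I. a j l * u l)" if j: "j \<in> I" for j
  proof (rule LIMSEQ_unique)
    show "(\<lambda>t. x (Suc (r t)) j) \<longlonglongrightarrow> (\<Sum>l\<in>I. a j l * u l)"
      unfolding step[OF j] by (intro tendsto_intros u)
    have "(\<lambda>t. (x (Suc (r t)) j - x (r t) j) + x (r t) j) \<longlonglongrightarrow> 0 + u j"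
      using LIMSEQ_subseq_LIMSEQ[OF increment[OF j] r(1)] u[OF j]
      by (intro tendsto_add) (auto simp: comp_def)
    then show "(\<lambda>t. x (Suc (r t)) j) \<longlonglongrightarrow> u j" by simp
  qed
  have "(\<lambda>t. x t i) \<longlonglongrightarrow> u i"
  proof (rule tendstoI)
    fix e :: real assume "0 < e"
    have "\<forall>\<^sub>F t in sequentially. \<forall>j\<in>I. dist (x (r t) j) (u j) < e / 2"
      using finite_I tendstoD[OF u, of _ "e / 2"] \<open>0 < e\<close> by (simp add: eventually_ball_finite_distrib)
    then obtain t0 where t0: "\<forall>j\<in>I. \<bar>x (r t0) j - u j\<bar> \<le> e / 2"
      unfolding eventually_sequentially dist_real_def by (meson less_imp_le order_refl)
    have "\<forall>j\<in>I. \<bar>x t j - u j\<bar> \<le> e / 2" if "r t0 \<le> t" for t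
      using that
    proof (induction rule: dec_induct)
      case (step t)
      show ?case
      proof
        fix j assume j: "j \<in> I"
        have "x (Suc t) j - u j = (\<Sum>l\<in>I. a j l * (x t l - u l))"
          using assms(1)[OF j] fixed[OF j] by (simp add: right_diff_distrib sum_subtractf)
        also have "\<bar>\<dots>\<bar> \<le> e / 2" using step.IH by (intro average_abs_le j) auto
        finally show "\<bar>x (Suc t) j - u j\<bar> \<le> e / 2" .
      qed
    qed (rule t0)
    then show "\<forall>\<^sub>F t in sequentially. dist (x t i) (u i) < e"
      using i \<open>0 < e\<close> by (fastforce simp: eventually_sequentially dist_real_def)
  qed
  then show ?thesis by (rule convergentI)
qed

text \<open>An average of numbers that do not exceed \<open>u i\<close> equals \<open>u i\<close> only if each number of positive weight
  does.\<close>

lemma harmonic_max: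
  assumes harmonic: "u i = (\<Sum>j\<in>I. a i j * u j)"
    and i: "i \<in> I" and le: "\<And>j. j \<in> I \<Longrightarrow> 0 < a i j \<Longrightarrow> u j \<le> u i"
    and j: "j \<in> I" "0 < a i j"
  shows "u j = u i"
proof -
  have "(\<Sum>l\<in>I. a i l * (u i - u l)) = 0"
    using harmonic by (simp add: right_diff_distrib sum_subtractf average_const i)
  moreover have "0 \<le> a i l * (u i - u l)" if "l \<in> I" for l
    using le[OF that] nonneg[OF i that] by (cases "a i l = 0") (auto intro: mult_nonneg_nonneg)
  ultimately have "a i j * (u i - u j) = 0"
    using sum_nonneg_eq_0_iff[OF finite_I, of "\<lambda>l. a i l * (u i - u l)"] j(1) by simp
  then show ?thesis using j(2) by simp
qed

end


section \<open>Sinks of the condensation digraph\<close>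

context fin_digraph
begin

lemma sink_sccs_subset: "sink_sccs G \<subseteq> sccs"
  by (auto simp: sink_sccs_def condensation_def)

lemma finite_sccs: "finite sccs"
  unfolding sccs_conv_sccs_verts using finite_sccs_verts by simp

lemma scc_eqI: "H \<in> sccs \<Longrightarrow> H' \<in> sccs \<Longrightarrow> u \<in> verts H \<Longrightarrow> u \<in> verts H' \<Longrightarrow> H = H'"
  using sccs_verts_disjoint[of "verts H" "verts H'"] inj_onD[OF inj_on_verts_sccs, of H H']
  by (auto simp: sccs_verts_conv)

lemma scc_cover: "u \<in> verts G \<Longrightarrow> \<exists>H\<in>sccs. u \<in> verts H"
  using in_scc_of_self scc_of_in_sccs_verts sccs_verts_conv by blast

lemma scc_verts: "H \<in> sccs \<Longrightarrow> verts H \<subseteq> verts G"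
  by (rule sccs_verts_subsets) (simp add: sccs_verts_conv)

lemma scc_reachable:
  assumes "H \<in> sccs" "u \<in> verts H" "v \<in> verts H"
  shows "u \<rightarrow>\<^sup>*\<^bsub>G\<^esub> v"
proof -
  have "verts H \<in> sccs_verts" using assms(1) by (simp add: sccs_verts_conv)
  then show ?thesis using assms by (simp add: in_sccs_verts_conv_reachable)
qed

lemma scc_adj:
  assumes "H \<in> sccs"
  shows "u \<rightarrow>\<^bsub>H\<^esub> v \<longleftrightarrow> u \<rightarrow>\<^bsub>G\<^esub> v \<and> u \<in> verts H \<and> v \<in> verts H"
proof -
  have "H = G \<restriction> verts H" using assms sccs_conv_sccs_verts by auto
  moreover have "u \<rightarrow>\<^bsub>G \<restriction> S\<^esub> v \<longleftrightarrow> u \<rightarrow>\<^bsub>G\<^esub> v \<and> u \<in> S \<and> v \<in> S" for S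
    by (auto simp: arcs_ends_def arc_to_ends_def)
  ultimately show ?thesis by metis
qed

text \<open>The out-degree of an infinite set of arcs would be \<open>0\<close> as well, so finiteness of the condensation
  digraph matters here.\<close>

lemma sink_sccs_iff:
  "H \<in> sink_sccs G \<longleftrightarrow> H \<in> sccs \<and> (\<forall>u\<in>verts H. \<forall>v. u \<rightarrow>\<^bsub>G\<^esub> v \<longrightarrow> v \<in> verts H)"
proof (cases "H \<in> sccs")
  case True
  have out: "out_arcs (condensation G) H
      = {(H1, H2). H1 = H \<and> H2 \<in> sccs \<and> H \<noteq> H2 \<and> (\<exists>u\<in>verts H. \<exists>v\<in>verts H2. u \<rightarrow>\<^bsub>G\<^esub> v)}"
    using True by (auto simp: out_arcs_def condensation_def)
  have "finite (out_arcs (condensation G) H)"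
    by (rule finite_subset[of _ "sccs \<times> sccs"]) (use finite_sccs True in \<open>auto simp: out\<close>)
  then have "H \<in> sink_sccs G \<longleftrightarrow> out_arcs (condensation G) H = {}"
    using True by (simp add: sink_sccs_def condensation_def out_degree_def)
  also have "\<dots> \<longleftrightarrow> (\<forall>u\<in>verts H. \<forall>v. u \<rightarrow>\<^bsub>G\<^esub> v \<longrightarrow> v \<in> verts H)"
  proof
    assume empty: "out_arcs (condensation G) H = {}"
    show "\<forall>u\<in>verts H. \<forall>v. u \<rightarrow>\<^bsub>G\<^esub> v \<longrightarrow> v \<in> verts H"
    proof (intro ballI allI impI)
      fix u v assume uv: "u \<in> verts H" "u \<rightarrow>\<^bsub>G\<^esub> v"
      obtain H2 where "H2 \<in> sccs" "v \<in> verts H2" using scc_cover adj_in_verts(2)[OF uv(2)] by blast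
      then show "v \<in> verts H" using empty uv unfolding out by blast
    qed
  next
    assume "\<forall>u\<in>verts H. \<forall>v. u \<rightarrow>\<^bsub>G\<^esub> v \<longrightarrow> v \<in> verts H"
    then show "out_arcs (condensation G) H = {}" using True scc_eqI unfolding out by blast
  qed
  finally show ?thesis using True by simp
qed (use sink_sccs_subset in blast)

lemma sink_reachable_closed:
  assumes "H \<in> sink_sccs G" "u \<in> verts H" "u \<rightarrow>\<^sup>*\<^bsub>G\<^esub> v"
  shows "v \<in> verts H"
  using assms(3) by (induction rule: reachable_induct) (use assms(1,2) sink_sccs_iff in auto)

text \<open>Among the nodes that are reachable from \<open>u\<close>, one that reaches the fewest nodes lies in a sink.\<close>

lemma reaches_sink:
  assumes "u \<in> verts G"
  shows "\<exists>H\<in>sink_sccs G. \<exists>v\<in>verts H. u \<rightarrow>\<^sup>*\<^bsub>G\<^esub> v"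
proof -
  let ?R = "\<lambda>v. {w. v \<rightarrow>\<^sup>*\<^bsub>G\<^esub> w}"
  obtain v where v: "u \<rightarrow>\<^sup>*\<^bsub>G\<^esub> v" and least: "\<And>w. u \<rightarrow>\<^sup>*\<^bsub>G\<^esub> w \<Longrightarrow> card (?R v) \<le> card (?R w)"
    using ex_has_least_nat[of "\<lambda>v. u \<rightarrow>\<^sup>*\<^bsub>G\<^esub> v" u "\<lambda>v. card (?R v)"] assms reachable_refl by blast
  have fin: "finite (?R w)" for w
    by (rule finite_subset[of _ "verts G"]) (auto dest: reachable_in_verts(2))
  have returns: "w \<rightarrow>\<^sup>*\<^bsub>G\<^esub> v" if w: "v \<rightarrow>\<^sup>*\<^bsub>G\<^esub> w" for w
  proof -
    have "?R w \<subseteq> ?R v" using w reachable_trans by blast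
    moreover have "card (?R v) \<le> card (?R w)" using least v w reachable_trans by blast
    ultimately have "?R w = ?R v" using fin card_seteq by metis
    then show ?thesis using v reachable_in_verts(2)[OF v] by blast
  qed
  obtain H where H: "H \<in> sccs" "v \<in> verts H"
    using scc_cover reachable_in_verts(2)[OF v] by blast
  have "w' \<in> verts H" if "w \<in> verts H" "w \<rightarrow>\<^bsub>G\<^esub> w'" for w w'
  proof -
    have vw': "v \<rightarrow>\<^sup>*\<^bsub>G\<^esub> w'" using scc_reachable[OF H that(1)] that(2) reachable_adj_trans by blast
    have "verts H \<in> sccs_verts" using H(1) by (simp add: sccs_verts_conv)
    then show ?thesis
      using vw' returns[OF vw'] H(2) unfolding in_sccs_verts_conv_reachable by blast
  qed
  then have "H \<in> sink_sccs G" using H(1) by (auto simp: sink_sccs_iff)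
  then show ?thesis using H(2) v by blast
qed

text \<open>A weakly connected component is a strongly connected component of the symmetric closure.\<close>

lemma wcc_closed:
  assumes W: "W \<in> wccs G" and u: "u \<in> verts W" "u \<rightarrow>\<^sup>*\<^bsub>G\<^esub> v \<or> v \<rightarrow>\<^sup>*\<^bsub>G\<^esub> u"
  shows "v \<in> verts W"
proof -
  interpret Q: pair_wf_digraph "mk_symmetric G" ..
  have sym: "a \<rightarrow>\<^sup>*\<^bsub>mk_symmetric G\<^esub> b" if "b \<rightarrow>\<^sup>*\<^bsub>mk_symmetric G\<^esub> a" for a b
    using symmetric_mk_symmetric that by (rule symmetric_reachable)
  have "verts W \<in> Q.sccs_verts" using W wccs_verts_conv by blast
  moreover have "u \<rightarrow>\<^sup>*\<^bsub>mk_symmetric G\<^esub> v" using u(2) reachable_mk_symmetricI sym by blast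
  ultimately show ?thesis
    using u(1) sym unfolding Q.in_sccs_verts_conv_reachable by blast
qed

lemma wcc_verts: "W \<in> wccs G \<Longrightarrow> verts W \<subseteq> verts G"
  by (auto simp: wccs_def max_subgraph_def subgraph_def)

end

section \<open>Harmonic vectors on the proximity digraph\<close>

locale proximity =
  fixes k :: bounded_model and n :: nat and r y :: "real vec"
  assumes dim_y: "dim_vec y = n" and bounds_pos: "i < n \<Longrightarrow> 0 < r $ i"
begin

abbreviation "G \<equiv> prox_digraph k r y"
abbreviation "N \<equiv> out_nbrs k r y"
abbreviation "A \<equiv> adj_mat k r y"

lemma A_carrier: "A \<in> carrier_mat n n"
  by (simp add: adj_mat_def dim_y)

lemma verts_G: "verts G = {..<n}"
  by (simp add: prox_digraph_def dim_y)

lemma adj_G: "i \<rightarrow>\<^bsub>G\<^esub> j \<longleftrightarrow> i < n \<and> j \<in> N i"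
  by (simp add: prox_digraph_def dim_y)

lemma N_subset: "N i \<subseteq> {..<n}"
  by (auto simp: out_nbrs_def dim_y)

lemma finite_N: "finite (N i)"
  using N_subset finite_subset by blast

text \<open>Equal opinions give arcs in both directions, whichever of the two agents sets the bound. This
  makes the sinks of an equilibrium complete; with \<open>i = j\<close> it gives the self-loops.\<close>

lemma equal_opinions_adj: "i < n \<Longrightarrow> j < n \<Longrightarrow> y $ i = y $ j \<Longrightarrow> j \<in> N i"
  using bounds_pos[of i] bounds_pos[of j] by (auto simp: out_nbrs_def dim_y split: bounded_model.split)

lemma A_entry:
  "i < n \<Longrightarrow> j < n \<Longrightarrow> A $$ (i, j) = (if j \<in> N i then 1 / real (card (N i)) else 0)"
  by (simp add: adj_mat_def dim_y)

lemma A_pos_iff: "i < n \<Longrightarrow> j < n \<Longrightarrow> 0 < A $$ (i, j) \<longleftrightarrow> i \<rightarrow>\<^bsub>G\<^esub> j"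
  using finite_N[of i] by (auto simp: A_entry adj_G card_gt_0_iff)

sublocale graph: fin_digraph G
proof
  have "arcs G \<subseteq> {..<n} \<times> {..<n}"
    using N_subset by (auto simp: prox_digraph_def dim_y)
  then show "finite (arcs G)" by (rule finite_subset) simp
qed (auto simp: prox_digraph_def dim_y dest: subsetD[OF N_subset])

sublocale lazy_averaging "{..<n}" "\<lambda>i j. A $$ (i, j)"
proof
  fix i assume i: "i \<in> {..<n}"
  have ne: "i \<in> N i" using equal_opinions_adj i by simp
  have "(\<Sum>j<n. A $$ (i, j)) = (\<Sum>j<n. if j \<in> N i then 1 / real (card (N i)) else 0)"
    using i by (intro sum.cong) (auto simp: A_entry)
  also have "\<dots> = (\<Sum>j\<in>N i. 1 / real (card (N i)))"
    using N_subset[of i] by (simp add: sum.inter_restrict[symmetric] Int_absorb1)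
  also have "\<dots> = 1" using ne finite_N[of i] by (auto simp: card_gt_0_iff)
  finally show "(\<Sum>j<n. A $$ (i, j)) = 1" .
  show "0 < A $$ (i, i)" using i ne by (simp add: A_pos_iff adj_G)
qed (auto simp: A_entry)

definition harmonic :: "(nat \<Rightarrow> real) \<Rightarrow> bool" where
  "harmonic u \<longleftrightarrow> (\<forall>i<n. u i = (\<Sum>j<n. A $$ (i, j) * u j))"

text \<open>The maximum at \<open>i\<close> passes along each arc to the next node on a walk from \<open>i\<close>, since all out-neighbours of
  that node are reachable from \<open>i\<close> too.\<close>

lemma maximum_principle:
  assumes u: "harmonic u" and le: "\<And>l. i \<rightarrow>\<^sup>*\<^bsub>G\<^esub> l \<Longrightarrow> u l \<le> u i" and ij: "i \<rightarrow>\<^sup>*\<^bsub>G\<^esub> j"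
  shows "u j = u i"
  using ij
proof (induction rule: graph.reachable_induct)
  case (step j l)
  have jl: "j < n" "l < n" using graph.adj_in_verts[OF step.hyps(2)] by (simp_all add: verts_G)
  have "u l = u j"
  proof (rule harmonic_max[of u j l])
    show "u j = (\<Sum>l<n. A $$ (j, l) * u l)" using u jl by (simp add: harmonic_def)
    fix m assume "m \<in> {..<n}" "0 < A $$ (j, m)"
    then have "j \<rightarrow>\<^bsub>G\<^esub> m" using A_pos_iff jl by simp
    then show "u m \<le> u j" using le[of m] step graph.reachable_adj_trans by metis
  qed (use jl step.hyps(2) A_pos_iff in auto)
  then show ?case using step.IH by simp
qed simp

lemma harmonic_minus: "harmonic u \<Longrightarrow> harmonic (\<lambda>i. - u i)"
  by (simp add: harmonic_def sum_negf)

lemma harmonic_nonpos: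
  assumes u: "harmonic u" and sinks: "\<And>H j. H \<in> sink_sccs G \<Longrightarrow> j \<in> verts H \<Longrightarrow> u j \<le> 0"
    and "i < n"
  shows "u i \<le> 0"
proof -
  let ?M = "Max (u ` {..<n})"
  have "?M \<in> u ` {..<n}" using \<open>i < n\<close> by (intro Max_in) auto
  then obtain l where l: "l < n" "u l = ?M" by auto
  have le: "u j \<le> u l" if "j < n" for j using that l by simp
  obtain H j where "H \<in> sink_sccs G" "j \<in> verts H" and lj: "l \<rightarrow>\<^sup>*\<^bsub>G\<^esub> j"
    using graph.reaches_sink[of l] l verts_G by blast
  moreover have "u j = u l"
    by (rule maximum_principle[OF u _ lj]) (use le graph.reachable_in_verts(2) verts_G in blast)
  ultimately have "u l \<le> 0" using sinks by metis
  then show ?thesis using le[OF \<open>i < n\<close>] by simp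
qed

text \<open>Every node reaches a sink, so a positive maximum or a negative minimum would propagate along
  arcs to a sink.\<close>

lemma harmonic_zero:
  assumes "harmonic u" and "\<And>H j. H \<in> sink_sccs G \<Longrightarrow> j \<in> verts H \<Longrightarrow> u j = 0" and "i < n"
  shows "u i = 0"
  using harmonic_nonpos[OF assms(1) _ assms(3)] harmonic_nonpos[OF harmonic_minus[OF assms(1)] _ assms(3)]
    assms(2) by force

section \<open>Equilibria\<close>

lemma equilibrium_harmonic:
  assumes "equilibrium k r y"
  shows "harmonic (\<lambda>i. y $ i)"
  unfolding harmonic_def
proof (intro allI impI)
  fix i assume i: "i < n"
  have "y $ i = (A *\<^sub>v y) $ i" using assms unfolding equilibrium_def by simp
  also have "\<dots> = (\<Sum>j<n. A $$ (i, j) * y $ j)"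
    using i A_carrier dim_y by (auto simp: scalar_prod_def atLeast0LessThan)
  finally show "y $ i = (\<Sum>j<n. A $$ (i, j) * y $ j)" .
qed

lemma equilibrium_constant_on_sink:
  assumes eq: "equilibrium k r y" and H: "H \<in> sink_sccs G" and ij: "i \<in> verts H" "j \<in> verts H"
  shows "y $ i = y $ j"
proof -
  have scc: "H \<in> graph.sccs" using H graph.sink_sccs_subset by blast
  have fin: "finite (verts H)"
    using graph.scc_verts[OF scc] graph.finite_verts by (rule finite_subset)
  let ?M = "Max ((\<lambda>j. y $ j) ` verts H)"
  have "?M \<in> (\<lambda>j. y $ j) ` verts H" using fin ij by (intro Max_in) auto
  then obtain l where l: "l \<in> verts H" "y $ l = ?M" by auto
  have "y $ m = y $ l" if "m \<in> verts H" for m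
  proof (rule maximum_principle[OF equilibrium_harmonic[OF eq]])
    show "l \<rightarrow>\<^sup>*\<^bsub>G\<^esub> m" using graph.scc_reachable[OF scc l(1) that] .
    show "y $ m' \<le> y $ l" if "l \<rightarrow>\<^sup>*\<^bsub>G\<^esub> m'" for m'
      using graph.sink_reachable_closed[OF H l(1) that] fin l(2) by simp
  qed
  then show ?thesis using ij by metis
qed

text \<open>A sink whose agents agree is complete, as agents with equal opinions are adjacent.\<close>

lemma equilibrium_no_moderate_minded:
  assumes "equilibrium k r y"
  shows "moderate_minded G = {}"
proof -
  have "complete_subgraph H" if H: "H \<in> sink_sccs G" for H
    unfolding complete_subgraph_def
  proof (intro ballI)
    fix i j assume ij: "i \<in> verts H" "j \<in> verts H"
    have scc: "H \<in> graph.sccs" using H graph.sink_sccs_subset by blast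
    then have "verts H \<subseteq> {..<n}" using graph.scc_verts verts_G by simp
    then show "i \<rightarrow>\<^bsub>H\<^esub> j"
      using equal_opinions_adj[OF _ _ equilibrium_constant_on_sink[OF assms H ij]] ij
      by (auto simp: graph.scc_adj[OF scc] adj_G)
  qed
  then show ?thesis by (auto simp: moderate_minded_def)
qed

text \<open>Everything reachable from \<open>i\<close> stays inside the weakly connected component, so the extremum at
  \<open>i\<close> spreads to a sink. Equality of opinions then provides an arc from the sink to \<open>i\<close>, which no arc
  can leave.\<close>

lemma equilibrium_extremum_closed_minded:
  assumes eq: "equilibrium k r y" and W: "W \<in> wccs G" "i \<in> verts W"
    and extremum: "y $ i = Max ((\<lambda>j. y $ j) ` verts W) \<or> y $ i = Min ((\<lambda>j. y $ j) ` verts W)"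
  shows "\<exists>H\<in>closed_minded G. verts H \<subseteq> verts W \<and> i \<in> verts H"
proof -
  have fin: "finite (verts W)" using graph.wcc_verts[OF W(1)] graph.finite_verts by (rule finite_subset)
  have i: "i < n" using graph.wcc_verts[OF W(1)] W(2) verts_G by auto
  have reach_W: "l \<in> verts W" if "i \<rightarrow>\<^sup>*\<^bsub>G\<^esub> l" for l
    using graph.wcc_closed[OF W] that by blast
  have const: "y $ j = y $ i" if ij: "i \<rightarrow>\<^sup>*\<^bsub>G\<^esub> j" for j
    using extremum
  proof
    assume max: "y $ i = Max ((\<lambda>j. y $ j) ` verts W)"
    show ?thesis
      by (rule maximum_principle[OF equilibrium_harmonic[OF eq] _ ij])
        (use fin reach_W in \<open>auto simp: max\<close>)
  next
    assume min: "y $ i = Min ((\<lambda>j. y $ j) ` verts W)"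
    have "- y $ j = - y $ i"
      by (rule maximum_principle[OF harmonic_minus[OF equilibrium_harmonic[OF eq]] _ ij])
        (use fin reach_W in \<open>auto simp: min\<close>)
    then show ?thesis by simp
  qed
  obtain H j where H: "H \<in> sink_sccs G" "j \<in> verts H" and ij: "i \<rightarrow>\<^sup>*\<^bsub>G\<^esub> j"
    using graph.reaches_sink[of i] i verts_G by blast
  \<comment> \<open>Agents with equal opinions influence each other, so the arc back into \<open>i\<close> exists.\<close>
  have "j \<rightarrow>\<^bsub>G\<^esub> i"
    using equal_opinions_adj[of j i] const[OF ij] i graph.reachable_in_verts(2)[OF ij]
    by (simp add: adj_G verts_G)
  then have iH: "i \<in> verts H" using H by (auto simp: graph.sink_sccs_iff)
  have "H \<in> graph.sccs" using H(1) graph.sink_sccs_subset by blast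
  then have "verts H \<subseteq> verts W"
    using graph.scc_reachable iH reach_W by blast
  moreover have "H \<in> closed_minded G"
    using H(1) equilibrium_no_moderate_minded[OF eq] by (auto simp: closed_minded_def moderate_minded_def)
  ultimately show ?thesis using iH by blast
qed

end


section \<open>Limits and submatrices\<close>

lemma vec_lim_eqI:
  assumes "vec_tendsto X v"
  shows "vec_lim X = v"
  unfolding vec_lim_def
proof (rule the_equality[where P = "vec_tendsto X", OF assms])
  fix w assume "vec_tendsto X w"
  with assms show "w = v"
    by (intro eq_vecI) (auto simp: vec_tendsto_def intro: LIMSEQ_unique)
qed

lemma mat_lim_eqI:
  assumes "mat_tendsto X B"
  shows "mat_lim X = B"
  unfolding mat_lim_def
proof (rule the_equality[where P = "mat_tendsto X", OF assms])
  fix D assume "mat_tendsto X D"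
  with assms show "D = B"
    by (intro eq_matI) (auto simp: mat_tendsto_def intro!: LIMSEQ_unique[of "\<lambda>t. X t $$ _"])
qed

lemma pow_mat_Suc_left:
  assumes "B \<in> carrier_mat n n"
  shows "B ^\<^sub>m Suc t = B * B ^\<^sub>m t"
proof (induction t)
  case 0
  show ?case using assms by simp
next
  case (Suc t)
  have "B ^\<^sub>m Suc (Suc t) = B * B ^\<^sub>m t * B" using Suc.IH by simp
  also have "\<dots> = B * (B ^\<^sub>m t * B)" using assms by (intro assoc_mult_mat) auto
  finally show ?case by simp
qed

lemma mat_select_dim [simp]:
  "dim_row (mat_select B is js) = length is" "dim_col (mat_select B is js) = length js"
  by (simp_all add: mat_select_def)

lemma mat_select_carrier [simp]: "mat_select B is js \<in> carrier_mat (length is) (length js)"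
  by (simp add: mat_select_def)

lemma mat_select_index [simp]:
  "a < length is \<Longrightarrow> b < length js \<Longrightarrow> mat_select B is js $$ (a, b) = B $$ (is ! a, js ! b)"
  by (simp add: mat_select_def)

lemma mat_select_cong:
  assumes "\<And>u v. u \<in> set is \<Longrightarrow> v \<in> set js \<Longrightarrow> B $$ (u, v) = D $$ (u, v)"
  shows "mat_select B is js = mat_select D is js"
  by (rule eq_matI) (use assms in auto)

lemma mat_select_zero:
  assumes "\<And>u v. u \<in> set is \<Longrightarrow> v \<in> set js \<Longrightarrow> B $$ (u, v) = 0"
  shows "mat_select B is js = 0\<^sub>m (length is) (length js)"
  by (rule eq_matI) (use assms in auto)

lemma mat_select_mult_index:
  assumes "a < length is" "b < length js"
  shows "(mat_select B is ks * mat_select D ks js) $$ (a, b) =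
    (\<Sum>l\<leftarrow>ks. B $$ (is ! a, l) * (D $$ (l, js ! b) :: real))"
  using assms by (simp add: scalar_prod_def sum_list_sum_nth)

text \<open>Block multiplication in terms of index lists: the sum over the common index splits along a
  partition of \<open>{..<n}\<close> into three lists.\<close>

lemma mat_select_mult_three_blocks:
  fixes B D :: "real mat"
  assumes B: "B \<in> carrier_mat n n" and D: "D \<in> carrier_mat n n"
    and ks: "distinct (ks1 @ ks2 @ ks3)" "set (ks1 @ ks2 @ ks3) = {..<n}"
    and sub: "set is \<subseteq> {..<n}" "set js \<subseteq> {..<n}"
  shows "mat_select (B * D) is js =
    mat_select B is ks1 * mat_select D ks1 js +
    (mat_select B is ks2 * mat_select D ks2 js + mat_select B is ks3 * mat_select D ks3 js)"
proof (rule eq_matI)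
  fix a b
  assume "a < dim_row (mat_select B is ks1 * mat_select D ks1 js +
      (mat_select B is ks2 * mat_select D ks2 js + mat_select B is ks3 * mat_select D ks3 js))"
    and "b < dim_col (mat_select B is ks1 * mat_select D ks1 js +
      (mat_select B is ks2 * mat_select D ks2 js + mat_select B is ks3 * mat_select D ks3 js))"
  then have ab: "a < length is" "b < length js" by simp_all
  then have lt: "is ! a < n" "js ! b < n" using sub nth_mem by (blast dest: subsetD)+
  have "mat_select (B * D) is js $$ (a, b) = (\<Sum>l<n. B $$ (is ! a, l) * D $$ (l, js ! b))"
    using ab lt B D by (simp add: scalar_prod_def atLeast0LessThan)
  also have "\<dots> = (\<Sum>l\<leftarrow>ks1 @ ks2 @ ks3. B $$ (is ! a, l) * D $$ (l, js ! b))"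
    using ks by (subst sum_list_distinct_conv_sum_set) auto
  finally show "mat_select (B * D) is js $$ (a, b) =
      (mat_select B is ks1 * mat_select D ks1 js +
      (mat_select B is ks2 * mat_select D ks2 js + mat_select B is ks3 * mat_select D ks3 js)) $$ (a, b)"
    using ab by (simp add: mat_select_mult_index del: index_mult_mat(1))
qed simp_all

lemma canonical_block_index:
  fixes C M L1 L2 T :: "real mat"
  assumes "a < dim_row C + dim_row M + dim_row T" "b < dim_col C + dim_col M + dim_col T"
    and "dim_row L1 = dim_row T" "dim_col L1 = dim_col C" "dim_row L2 = dim_row T" "dim_col L2 = dim_col M"
  shows "canonical_block C M L1 L2 T $$ (a, b) =
    (if a < dim_row C then if b < dim_col C then C $$ (a, b) else 0
     else if a < dim_row C + dim_row M
       then if b < dim_col C then 0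
         else if b < dim_col C + dim_col M then M $$ (a - dim_row C, b - dim_col C) else 0
     else if b < dim_col C then L1 $$ (a - (dim_row C + dim_row M), b)
     else if b < dim_col C + dim_col M then L2 $$ (a - (dim_row C + dim_row M), b - dim_col C)
     else T $$ (a - (dim_row C + dim_row M), b - (dim_col C + dim_col M)))"
  unfolding canonical_block_def using assms by auto

lemma canonical_block_dim:
  "dim_row (canonical_block C M L1 L2 T) = dim_row C + dim_row M + dim_row T"
  "dim_col (canonical_block C M L1 L2 T) = dim_col C + dim_col M + dim_col T"
  by (simp_all add: canonical_block_def)

lemma mat_select_canonical_block:
  assumes "mat_select B cs ms = 0\<^sub>m (length cs) (length ms)"
    and "mat_select B cs os = 0\<^sub>m (length cs) (length os)"
    and "mat_select B ms cs = 0\<^sub>m (length ms) (length cs)"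
    and "mat_select B ms os = 0\<^sub>m (length ms) (length os)"
  shows "mat_select B (cs @ ms @ os) (cs @ ms @ os) =
    canonical_block (mat_select B cs cs) (mat_select B ms ms) (mat_select B os cs) (mat_select B os ms)
      (mat_select B os os)"
proof (rule eq_matI)
  have zero: "B $$ (is ! a, js ! b) = 0"
    if "mat_select B is js = 0\<^sub>m (length is) (length js)" "a < length is" "b < length js" for "is" js a b
    using that mat_select_index[of a "is" b js B] by simp
  fix a b
  let ?K = "canonical_block (mat_select B cs cs) (mat_select B ms ms) (mat_select B os cs)
      (mat_select B os ms) (mat_select B os os)"
  assume "a < dim_row ?K" "b < dim_col ?K"
  then have ab: "a < length cs + length ms + length os" "b < length cs + length ms + length os"
    by (simp_all add: canonical_block_dim)
  show "mat_select B (cs @ ms @ os) (cs @ ms @ os) $$ (a, b) = ?K $$ (a, b)"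
    using ab zero[OF assms(1), of a "b - length cs"] zero[OF assms(2), of a "b - length cs - length ms"]
      zero[OF assms(3), of "a - length cs" b] zero[OF assms(4), of "a - length cs" "b - length cs - length ms"]
    by (subst canonical_block_index) (auto simp: nth_append)
qed (simp_all add: canonical_block_dim)

section \<open>The limit of the powers of the adjacency matrix\<close>

context proximity
begin

lemma pow_Suc_entry:
  assumes "i < n" "j < n"
  shows "(A ^\<^sub>m Suc t) $$ (i, j) = (\<Sum>l<n. A $$ (i, l) * (A ^\<^sub>m t) $$ (l, j))"
  using assms A_carrier pow_carrier_mat[OF A_carrier, of t] unfolding pow_mat_Suc_left[OF A_carrier]
  by (simp add: scalar_prod_def atLeast0LessThan)

definition A_lim :: "real mat" where
  "A_lim = mat n n (\<lambda>(i, j). lim (\<lambda>t. (A ^\<^sub>m t) $$ (i, j)))"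

lemma A_lim_carrier: "A_lim \<in> carrier_mat n n"
  by (simp add: A_lim_def)

lemma tendsto_A_lim:
  assumes "i < n" "j < n"
  shows "(\<lambda>t. (A ^\<^sub>m t) $$ (i, j)) \<longlonglongrightarrow> A_lim $$ (i, j)"
proof -
  have "convergent (\<lambda>t. (A ^\<^sub>m t) $$ (i, j))"
    by (rule convergent_orbit[where x = "\<lambda>t i. (A ^\<^sub>m t) $$ (i, j)"])
      (use assms pow_Suc_entry in auto)
  then show ?thesis using assms by (simp add: A_lim_def convergent_LIMSEQ_iff)
qed

lemma harmonic_A_lim:
  assumes j: "j < n"
  shows "harmonic (\<lambda>i. A_lim $$ (i, j))"
  unfolding harmonic_def
proof (intro allI impI, rule LIMSEQ_unique)
  fix i assume i: "i < n"
  show "(\<lambda>t. (A ^\<^sub>m Suc t) $$ (i, j)) \<longlonglongrightarrow> A_lim $$ (i, j)"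
    by (rule LIMSEQ_Suc[OF tendsto_A_lim[OF i j]])
  show "(\<lambda>t. (A ^\<^sub>m Suc t) $$ (i, j)) \<longlonglongrightarrow> (\<Sum>l<n. A $$ (i, l) * A_lim $$ (l, j))"
    unfolding pow_Suc_entry[OF i j] by (intro tendsto_intros tendsto_A_lim) (use j in auto)
qed

lemma A_mult_A_lim: "A * A_lim = A_lim"
proof (rule eq_matI)
  fix i j assume "i < dim_row A_lim" "j < dim_col A_lim"
  then have "i < n" "j < n" using A_lim_carrier by auto
  then show "(A * A_lim) $$ (i, j) = A_lim $$ (i, j)"
    using harmonic_A_lim A_carrier A_lim_carrier by (simp add: harmonic_def scalar_prod_def atLeast0LessThan)
qed (use A_carrier A_lim_carrier in auto)

lemma sink_verts: "H \<in> sink_sccs G \<Longrightarrow> verts H \<subseteq> {..<n}"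
  using graph.scc_verts graph.sink_sccs_subset verts_G by auto

lemma A_sink_zero:
  assumes "H \<in> sink_sccs G" "i \<in> verts H" "j < n" "j \<notin> verts H"
  shows "A $$ (i, j) = 0"
proof -
  have "i < n" using sink_verts assms by auto
  moreover have "\<not> i \<rightarrow>\<^bsub>G\<^esub> j" using assms graph.sink_sccs_iff by auto
  ultimately show ?thesis using assms(3) by (auto simp: A_entry adj_G)
qed

lemma pow_sink_zero:
  assumes H: "H \<in> sink_sccs G" and j: "j < n" "j \<notin> verts H"
  shows "i \<in> verts H \<Longrightarrow> (A ^\<^sub>m t) $$ (i, j) = 0"
proof (induction t arbitrary: i)
  case 0
  then show ?case using sink_verts[OF H] j A_carrier by (auto simp: one_mat_def)
next
  case (Suc t)
  have "A $$ (i, l) * (A ^\<^sub>m t) $$ (l, j) = 0" if "l < n" for l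
    using Suc A_sink_zero[OF H Suc.prems that] by (cases "l \<in> verts H") auto
  moreover have i: "i < n" using Suc.prems sink_verts[OF H] by auto
  ultimately show ?case unfolding pow_Suc_entry[OF i j(1)] by (intro sum.neutral) auto
qed

lemma A_lim_sink_zero:
  assumes "H \<in> sink_sccs G" "i \<in> verts H" "j < n" "j \<notin> verts H"
  shows "A_lim $$ (i, j) = 0"
proof (rule LIMSEQ_unique)
  have "i < n" using sink_verts assms by auto
  then show "(\<lambda>t. (A ^\<^sub>m t) $$ (i, j)) \<longlonglongrightarrow> A_lim $$ (i, j)" using tendsto_A_lim assms by simp
  show "(\<lambda>t. (A ^\<^sub>m t) $$ (i, j)) \<longlonglongrightarrow> 0" using pow_sink_zero assms by simp
qed

lemma closed_minded_N:
  assumes "H \<in> closed_minded G" "i \<in> verts H"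
  shows "N i = verts H"
proof -
  have H: "H \<in> sink_sccs G" "complete_subgraph H" "H \<in> graph.sccs"
    using assms graph.sink_sccs_subset by (auto simp: closed_minded_def)
  have i: "i < n" using sink_verts[OF H(1)] assms(2) by auto
  show ?thesis
  proof (intro equalityI subsetI)
    fix j assume "j \<in> N i"
    then show "j \<in> verts H" using H(1) assms(2) i by (auto simp: graph.sink_sccs_iff adj_G)
  next
    fix j assume "j \<in> verts H"
    then show "j \<in> N i"
      using H(2) assms(2) by (auto simp: complete_subgraph_def graph.scc_adj[OF H(3)] adj_G)
  qed
qed

text \<open>All rows of a closed-minded component agree, so averaging a second time changes nothing.\<close>

lemma pow_closed_minded:
  assumes H: "H \<in> closed_minded G" and j: "j < n"
  shows "i \<in> verts H \<Longrightarrow> (A ^\<^sub>m Suc t) $$ (i, j) = A $$ (i, j)"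
proof (induction t arbitrary: i)
  case 0
  show ?case using A_carrier by simp
next
  case (Suc t)
  have sink: "H \<in> sink_sccs G" using H by (simp add: closed_minded_def)
  have i: "i < n" using sink_verts[OF sink] Suc.prems by auto
  have "A $$ (i, l) * (A ^\<^sub>m Suc t) $$ (l, j) = A $$ (i, l) * A $$ (i, j)" if l: "l < n" for l
  proof (cases "l \<in> verts H")
    case True
    then have "A $$ (l, j) = A $$ (i, j)"
      using closed_minded_N[OF H] Suc.prems i l j by (simp add: A_entry)
    then show ?thesis using Suc.IH[OF True] by simp
  next
    case False
    then show ?thesis using A_sink_zero[OF sink Suc.prems l] by simp
  qed
  then have "(A ^\<^sub>m Suc (Suc t)) $$ (i, j) = (\<Sum>l<n. A $$ (i, l) * A $$ (i, j))"
    unfolding pow_Suc_entry[OF i j, of "Suc t"] by (intro sum.cong) auto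
  then show ?case using average_const[of i] i by simp
qed

lemma A_lim_closed_minded:
  assumes H: "H \<in> closed_minded G" "i \<in> verts H" and j: "j < n"
  shows "A_lim $$ (i, j) = A $$ (i, j)"
proof (rule LIMSEQ_unique)
  have "i < n" using sink_verts[of H] H by (auto simp: closed_minded_def)
  then show "(\<lambda>t. (A ^\<^sub>m Suc t) $$ (i, j)) \<longlonglongrightarrow> A_lim $$ (i, j)" using LIMSEQ_Suc[OF tendsto_A_lim] j by simp
  show "(\<lambda>t. (A ^\<^sub>m Suc t) $$ (i, j)) \<longlonglongrightarrow> A $$ (i, j)"
    unfolding pow_closed_minded[OF H(1) j H(2)] by simp
qed

text \<open>A column of an agent outside the sinks is fixed by \<open>A\<close> and vanishes on the sinks, so it is zero
  by the maximum principle. This means that \<open>\<Theta> ^\<^sub>m t\<close> tends to zero.\<close>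

lemma A_lim_open_zero:
  assumes "j < n" "j \<notin> \<Union> (verts ` sink_sccs G)" "i < n"
  shows "A_lim $$ (i, j) = 0"
proof (rule harmonic_zero[OF harmonic_A_lim[OF assms(1)] _ assms(3)])
  fix H l assume "H \<in> sink_sccs G" "l \<in> verts H"
  then show "A_lim $$ (l, j) = 0" using A_lim_sink_zero assms by blast
qed

lemma fvct_seq_tendsto: "vec_tendsto (fvct_seq k r y) (A_lim *\<^sub>v y)"
  unfolding vec_tendsto_def
proof (intro conjI allI impI)
  fix t show "dim_vec (fvct_seq k r y t) = dim_vec (A_lim *\<^sub>v y)"
    using A_carrier A_lim_carrier by (simp add: fvct_seq_def)
next
  fix i assume "i < dim_vec (A_lim *\<^sub>v y)"
  then have i: "i < n" using A_lim_carrier by simp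
  have expand: "(B *\<^sub>v y) $ i = (\<Sum>j<n. B $$ (i, j) * y $ j)" if "B \<in> carrier_mat n n" for B
    using that i dim_y by (auto simp: scalar_prod_def atLeast0LessThan)
  show "(\<lambda>t. fvct_seq k r y t $ i) \<longlonglongrightarrow> (A_lim *\<^sub>v y) $ i"
    unfolding fvct_seq_def expand[OF A_lim_carrier] expand[OF pow_carrier_mat[OF A_carrier]]
    by (intro tendsto_intros tendsto_A_lim) (use i in auto)
qed

lemma fvct_eq: "fvct k r y = A_lim *\<^sub>v y"
  unfolding fvct_def by (rule vec_lim_eqI[OF fvct_seq_tendsto])

lemma A_mult_fvct: "A *\<^sub>v fvct k r y = fvct k r y"
  unfolding fvct_eq assoc_mult_mat_vec[OF A_carrier A_lim_carrier carrier_vecI[OF dim_y], symmetric] A_mult_A_lim ..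

end


section \<open>The block form of the limit\<close>

lemma inverse_mat_works:
  fixes B :: "real mat"
  assumes B: "B \<in> carrier_mat p p"
    and inj: "\<And>v. v \<in> carrier_vec p \<Longrightarrow> B *\<^sub>v v = 0\<^sub>v p \<Longrightarrow> v = 0\<^sub>v p"
  shows "invertible_mat B" "the (mat_inverse B) * B = 1\<^sub>m p" "the (mat_inverse B) \<in> carrier_mat p p"
proof -
  have "det B \<noteq> 0" using det_0_iff_vec_prod_zero[OF B] inj by blast
  then obtain D where D: "mat_inverse B = Some D"
    using mat_inverse(1)[OF B, where b = "()"] det_non_zero_imp_unit[OF B, where b = "()"] by (cases "mat_inverse B") auto
  then have "B * D = 1\<^sub>m p" "D * B = 1\<^sub>m p" "D \<in> carrier_mat p p"
    using mat_inverse(2)[OF B] by auto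
  then show "the (mat_inverse B) * B = 1\<^sub>m p" "the (mat_inverse B) \<in> carrier_mat p p" "invertible_mat B"
    using D B unfolding invertible_mat_def inverts_mat_def by auto
qed

text \<open>The lower blocks of the limit satisfy an equation of this kind, with \<open>T = \<Theta>\<close>.\<close>

lemma affine_fixed_point_solution:
  fixes T R X Y :: "real mat"
  assumes T: "T \<in> carrier_mat p p" and R: "R \<in> carrier_mat p p" "R * (1\<^sub>m p - T) = 1\<^sub>m p"
    and X: "X \<in> carrier_mat p q" and Y: "Y \<in> carrier_mat p q" and eq: "X = Y + T * X"
  shows "X = R * Y"
proof -
  have "(1\<^sub>m p - T) * X = X - T * X"
    using minus_mult_distrib_mat[OF one_carrier_mat T X] X by simp
  also have "\<dots> = Y"
  proof (rule eq_matI)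
    fix i j assume ij: "i < dim_row Y" "j < dim_col Y"
    have "X $$ (i, j) = (Y + T * X) $$ (i, j)" using eq by simp
    then show "(X - T * X) $$ (i, j) = Y $$ (i, j)"
      using ij X Y T by (simp del: index_mult_mat(1))
  qed (use X Y T in auto)
  finally have "R * Y = R * (1\<^sub>m p - T) * X"
    using assoc_mult_mat[OF R(1), of "1\<^sub>m p - T" p X q] T X by (simp add: minus_carrier_mat)
  then show ?thesis using R(2) X by simp
qed

text \<open>The order of the agents in a canonical form, flattened to one list for each of the three kinds:
  closed-, moderate- and open-minded.\<close>

locale ordered_proximity = proximity +
  fixes cs ms os :: "nat list"
  assumes distinct_order: "distinct (cs @ ms @ os)"
    and set_order: "set (cs @ ms @ os) = {..<n}"
    and set_cs: "set cs = \<Union> (verts ` closed_minded G)"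
    and set_ms: "set ms = \<Union> (verts ` moderate_minded G)"
begin

lemma set_sinks: "set cs \<union> set ms = \<Union> (verts ` sink_sccs G)"
  unfolding set_cs set_ms by (auto simp: closed_minded_def moderate_minded_def)

lemma lists_less: "i \<in> set cs \<Longrightarrow> i < n" "i \<in> set ms \<Longrightarrow> i < n" "i \<in> set os \<Longrightarrow> i < n"
  using set_order by auto

lemma cs_rows_zero:
  assumes "i \<in> set cs" "j < n" "j \<notin> set cs"
  shows "A $$ (i, j) = 0" "A_lim $$ (i, j) = 0"
proof -
  obtain H where H: "H \<in> sink_sccs G" "i \<in> verts H" and "verts H \<subseteq> set cs"
    using assms(1) unfolding set_cs by (auto simp: closed_minded_def)
  then have "j \<notin> verts H" using assms(3) by blast
  then show "A $$ (i, j) = 0" "A_lim $$ (i, j) = 0"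
    using H assms(2) A_sink_zero A_lim_sink_zero by auto
qed

lemma ms_rows_zero:
  assumes "i \<in> set ms" "j < n" "j \<notin> set ms"
  shows "A $$ (i, j) = 0" "A_lim $$ (i, j) = 0"
proof -
  obtain H where H: "H \<in> sink_sccs G" "i \<in> verts H" and "verts H \<subseteq> set ms"
    using assms(1) unfolding set_ms by (auto simp: moderate_minded_def)
  then have "j \<notin> verts H" using assms(3) by blast
  then show "A $$ (i, j) = 0" "A_lim $$ (i, j) = 0"
    using H assms(2) A_sink_zero A_lim_sink_zero by auto
qed

lemma disjoint_lists:
  "i \<in> set ms \<Longrightarrow> i \<notin> set cs" "i \<in> set os \<Longrightarrow> i \<notin> set cs"
  "i \<in> set cs \<Longrightarrow> i \<notin> set ms" "i \<in> set os \<Longrightarrow> i \<notin> set ms"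
  using distinct_order by auto

lemma zero_blocks:
  "mat_select A cs ms = 0\<^sub>m (length cs) (length ms)" "mat_select A cs os = 0\<^sub>m (length cs) (length os)"
  "mat_select A ms cs = 0\<^sub>m (length ms) (length cs)" "mat_select A ms os = 0\<^sub>m (length ms) (length os)"
  "mat_select A_lim cs ms = 0\<^sub>m (length cs) (length ms)" "mat_select A_lim cs os = 0\<^sub>m (length cs) (length os)"
  "mat_select A_lim ms cs = 0\<^sub>m (length ms) (length cs)" "mat_select A_lim ms os = 0\<^sub>m (length ms) (length os)"
  by (rule mat_select_zero; simp add: cs_rows_zero ms_rows_zero lists_less disjoint_lists)+

lemma A_lim_os_zero: "mat_select A_lim os os = 0\<^sub>m (length os) (length os)"
  by (rule mat_select_zero) (simp add: A_lim_open_zero lists_less disjoint_lists set_sinks[symmetric] del: Union_iff UN_iff)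

lemma A_lim_cs: "mat_select A_lim cs cs = mat_select A cs cs"
proof (rule mat_select_cong)
  fix i j assume "i \<in> set cs" "j \<in> set cs"
  then show "A_lim $$ (i, j) = A $$ (i, j)" using A_lim_closed_minded lists_less(1)[of j] set_cs by blast
qed

lemma A_canonical_block:
  "mat_select A (cs @ ms @ os) (cs @ ms @ os) =
    canonical_block (mat_select A cs cs) (mat_select A ms ms) (mat_select A os cs) (mat_select A os ms)
      (mat_select A os os)"
  by (rule mat_select_canonical_block) (rule zero_blocks)+

lemma A_lim_canonical_block:
  "mat_select A_lim (cs @ ms @ os) (cs @ ms @ os) =
    canonical_block (mat_select A cs cs) (mat_select A_lim ms ms) (mat_select A_lim os cs) (mat_select A_lim os ms)
      (0\<^sub>m (length os) (length os))"
  unfolding A_lim_cs[symmetric] A_lim_os_zero[symmetric]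
  by (rule mat_select_canonical_block) (rule zero_blocks)+

lemma block_mult:
  fixes B D :: "real mat"
  assumes "B \<in> carrier_mat n n" "D \<in> carrier_mat n n" "set is \<subseteq> {..<n}" "set js \<subseteq> {..<n}"
  shows "mat_select (B * D) is js = mat_select B is cs * mat_select D cs js +
    (mat_select B is ms * mat_select D ms js + mat_select B is os * mat_select D os js)"
  using mat_select_mult_three_blocks[OF assms(1,2) distinct_order set_order assms(3,4)] .

lemma set_lists: "set cs \<subseteq> {..<n}" "set ms \<subseteq> {..<n}" "set os \<subseteq> {..<n}"
  using set_order by auto

text \<open>No arc leaves the moderate-minded agents, so powers can be taken inside their block.\<close>

lemma M_pow: "mat_select A ms ms ^\<^sub>m t = mat_select (A ^\<^sub>m t) ms ms"
proof (induction t)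
  case 0
  have "distinct ms" using distinct_order by simp
  then show ?case
    using A_carrier lists_less(2) by (intro eq_matI) (auto simp: nth_eq_iff_index_eq)
next
  case (Suc t)
  have pow: "A ^\<^sub>m t \<in> carrier_mat n n" using A_carrier by simp
  have "mat_select (A ^\<^sub>m Suc t) ms ms = mat_select A ms ms * mat_select (A ^\<^sub>m t) ms ms"
    unfolding pow_mat_Suc_left[OF A_carrier] block_mult[OF A_carrier pow set_lists(2,2)] zero_blocks
    by (intro eq_matI) (simp_all del: index_mult_mat(1) add: left_mult_zero_mat[of _ _ "length ms"])
  also have "\<dots> = mat_select A ms ms ^\<^sub>m Suc t"
    unfolding pow_mat_Suc_left[OF mat_select_carrier] Suc.IH ..
  finally show ?case ..
qed

lemma M_pow_tendsto: "mat_tendsto (\<lambda>t. mat_select A ms ms ^\<^sub>m t) (mat_select A_lim ms ms)"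
  unfolding M_pow mat_tendsto_def using tendsto_A_lim lists_less(2) by auto

text \<open>A fixed vector of \<open>\<Theta>\<close>, extended by zero to the sinks, is harmonic and hence zero.\<close>

lemma open_block_injective:
  assumes v: "v \<in> carrier_vec (length os)" and zero: "(1\<^sub>m (length os) - mat_select A os os) *\<^sub>v v = 0\<^sub>v (length os)"
  shows "v = 0\<^sub>v (length os)"
proof -
  have fixed: "v $ a = (\<Sum>b<length os. A $$ (os ! a, os ! b) * v $ b)" if a: "a < length os" for a
  proof -
    have "((1\<^sub>m (length os) - mat_select A os os) *\<^sub>v v) $ a = v $ a - (mat_select A os os *\<^sub>v v) $ a"
      using minus_mult_distrib_mat_vec[OF one_carrier_mat mat_select_carrier v, of A] a v by simp
    then have "v $ a = (mat_select A os os *\<^sub>v v) $ a" using zero a by simp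
    also have "\<dots> = (\<Sum>b<length os. A $$ (os ! a, os ! b) * v $ b)"
      using a v by (simp add: scalar_prod_def atLeast0LessThan)
    finally show ?thesis .
  qed
  define u where "u i = (if i \<in> set os then \<Sum>b<length os. A $$ (i, os ! b) * v $ b else 0)" for i
  have u_nth: "u (os ! a) = v $ a" if "a < length os" for a using fixed that by (simp add: u_def)
  have u_sink: "u i = 0" if "i \<in> set cs \<union> set ms" for i
    using that disjoint_lists by (auto simp: u_def)
  have "harmonic u"
    unfolding harmonic_def
  proof (intro allI impI)
    fix i assume i: "i < n"
    have "(\<Sum>j<n. A $$ (i, j) * u j) = (\<Sum>j\<in>set os. A $$ (i, j) * u j)"
      using set_lists(3) by (intro sum.mono_neutral_right) (auto simp: u_def)
    also have "\<dots> = (\<Sum>j\<leftarrow>os. A $$ (i, j) * u j)"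
      using distinct_order by (subst sum_list_distinct_conv_sum_set) auto
    also have "\<dots> = (\<Sum>b<length os. A $$ (i, os ! b) * v $ b)"
      by (simp add: sum_list_sum_nth atLeast0LessThan u_nth)
    also have "\<dots> = u i"
    proof (cases "i \<in> set os")
      case False
      then have "A $$ (i, os ! b) = 0" if "b < length os" for b
        using i set_order that cs_rows_zero(1)[of i "os ! b"] ms_rows_zero(1)[of i "os ! b"]
          disjoint_lists lists_less(3) nth_mem[OF that] by (metis Un_iff lessThan_iff set_append)
      then show ?thesis using False by (simp add: u_def)
    qed (simp add: u_def)
    finally show "u i = (\<Sum>j<n. A $$ (i, j) * u j)" ..
  qed
  then have "u i = 0" if "i < n" for i
    using harmonic_zero[OF _ _ that] u_sink set_sinks by blast
  then show ?thesis using u_nth v lists_less(3) by (intro eq_vecI) (metis carrier_vecD index_zero_vec nth_mem)+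
qed

text \<open>The two lower blocks come from reading off the open-minded rows of \<open>A * A_lim = A_lim\<close>.\<close>

lemma open_block_invertible:
  defines "T \<equiv> mat_select A os os"
  defines "R \<equiv> the (mat_inverse (1\<^sub>m (length os) - T))"
  shows "invertible_mat (1\<^sub>m (length os) - T)"
    and "mat_select A_lim os cs = R * mat_select A os cs * mat_select A cs cs"
    and "mat_select A_lim os ms = R * mat_select A os ms * mat_select A_lim ms ms"
proof -
  have T: "T \<in> carrier_mat (length os) (length os)" by (simp add: T_def)
  have IT: "1\<^sub>m (length os) - T \<in> carrier_mat (length os) (length os)"
    using T by (simp add: minus_carrier_mat)
  show "invertible_mat (1\<^sub>m (length os) - T)"
    using inverse_mat_works(1)[OF IT] open_block_injective T_def by blast
  have R: "R \<in> carrier_mat (length os) (length os)" "R * (1\<^sub>m (length os) - T) = 1\<^sub>m (length os)"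
    using inverse_mat_works(2,3)[OF IT] open_block_injective unfolding R_def T_def by blast+
  have c: "mat_select A_lim os cs = mat_select A os cs * mat_select A cs cs + T * mat_select A_lim os cs"
    using block_mult[OF A_carrier A_lim_carrier set_lists(3,1)]
    unfolding A_mult_A_lim zero_blocks A_lim_cs T_def
    by (simp add: right_mult_zero_mat[of _ "length os"] left_add_zero_mat[of _ "length os" "length cs"]
        mult_carrier_mat[of _ "length os" "length os"])
  have m: "mat_select A_lim os ms = mat_select A os ms * mat_select A_lim ms ms + T * mat_select A_lim os ms"
    using block_mult[OF A_carrier A_lim_carrier set_lists(3,2)]
    unfolding A_mult_A_lim zero_blocks T_def
    by (simp add: right_mult_zero_mat[of _ "length os"] left_add_zero_mat[of _ "length os" "length ms"] add_carrier_mat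
        mult_carrier_mat[of _ "length os" "length os"])
  have "mat_select A_lim os cs = R * (mat_select A os cs * mat_select A cs cs)"
    by (rule affine_fixed_point_solution[OF T R mat_select_carrier _ c])
      (rule mult_carrier_mat[OF mat_select_carrier mat_select_carrier])
  then show "mat_select A_lim os cs = R * mat_select A os cs * mat_select A cs cs"
    by (simp add: assoc_mult_mat[OF R(1) mat_select_carrier mat_select_carrier])
  have "mat_select A_lim os ms = R * (mat_select A os ms * mat_select A_lim ms ms)"
    by (rule affine_fixed_point_solution[OF T R mat_select_carrier _ m])
      (rule mult_carrier_mat[OF mat_select_carrier mat_select_carrier])
  then show "mat_select A_lim os ms = R * mat_select A os ms * mat_select A_lim ms ms"
    by (simp add: assoc_mult_mat[OF R(1) mat_select_carrier mat_select_carrier])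
qed

lemma A_lim_conjugate:
  defines "P \<equiv> order_mat (cs @ ms @ os)"
  shows "A_lim = transpose_mat P * mat_select A_lim (cs @ ms @ os) (cs @ ms @ os) * P"
proof -
  let ?is = "cs @ ms @ os"
  have len: "length ?is = n" using distinct_card[OF distinct_order] set_order by simp
  have P: "P \<in> carrier_mat n n" unfolding P_def order_mat_def len by simp
  have Pt: "transpose_mat P \<in> carrier_mat n n" using P by simp
  have "P * transpose_mat P = mat_select (1\<^sub>m n) ?is ?is"
    using order_mat_conj[OF one_carrier_mat distinct_order set_order] P unfolding P_def by simp
  also have "\<dots> = 1\<^sub>m n"
  proof (rule eq_matI)
    fix a b assume "a < dim_row (1\<^sub>m n :: real mat)" "b < dim_col (1\<^sub>m n :: real mat)"
    then have ab: "a < length ?is" "b < length ?is" by (simp_all only: len index_one_mat)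
    then have "?is ! a < n" "?is ! b < n" using set_order nth_mem by blast+
    moreover have "?is ! a = ?is ! b \<longleftrightarrow> a = b" using distinct_order ab nth_eq_iff_index_eq by blast
    ultimately show "mat_select (1\<^sub>m n) ?is ?is $$ (a, b) = (1\<^sub>m n :: real mat) $$ (a, b)"
      using ab len by (simp only: mat_select_index) (simp add: len)
  qed (simp_all only: mat_select_dim len index_one_mat)
  finally have PPt: "P * transpose_mat P = 1\<^sub>m n" .
  have PtP: "transpose_mat P * P = 1\<^sub>m n"
    by (rule mat_mult_left_right_inverse[OF P Pt PPt])
  have "mat_select A_lim ?is ?is = P * A_lim * transpose_mat P"
    using order_mat_conj[OF A_lim_carrier distinct_order set_order] by (simp add: P_def)
  also have "transpose_mat P * (P * A_lim * transpose_mat P) * P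
      = (transpose_mat P * P) * A_lim * (transpose_mat P * P)"
    using P Pt A_lim_carrier by (simp add: assoc_mult_mat[of _ n n _ n _ n])
  also have "\<dots> = A_lim" unfolding PtP using A_lim_carrier by simp
  finally show ?thesis by simp
qed

end

section \<open>Canonical forms\<close>

text \<open>Used to replace the block diagonal matrices of a canonical form by the submatrices of \<open>A\<close>, given
  the block form of the permuted adjacency matrix.\<close>

lemma canonical_block_inject:
  fixes C M L1 L2 T :: "real mat"
  assumes eq: "canonical_block C M L1 L2 T = canonical_block C' M' L1 L2 T'"
    and dims: "dim_row C = dim_row C'" "dim_col C = dim_col C'" "dim_row M = dim_row M'"
      "dim_col M = dim_col M'" "dim_row T = dim_row T'" "dim_col T = dim_col T'"
      "dim_row L1 = dim_row T" "dim_col L1 = dim_col C" "dim_row L2 = dim_row T" "dim_col L2 = dim_col M"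
  shows "C = C'" "M = M'" "T = T'"
proof -
  have entry: "canonical_block C M L1 L2 T $$ (a, b) = canonical_block C' M' L1 L2 T' $$ (a, b)" for a b
    using eq by simp
  show "C = C'"
  proof (rule eq_matI)
    fix a b assume "a < dim_row C'" "b < dim_col C'"
    then show "C $$ (a, b) = C' $$ (a, b)"
      using entry[of a b] dims by (simp add: canonical_block_index)
  qed (use dims in auto)
  show "M = M'"
  proof (rule eq_matI)
    fix a b assume "a < dim_row M'" "b < dim_col M'"
    then show "M $$ (a, b) = M' $$ (a, b)"
      using entry[of "dim_row C + a" "dim_col C + b"] dims by (simp add: canonical_block_index)
  qed (use dims in auto)
  show "T = T'"
  proof (rule eq_matI)
    fix a b assume "a < dim_row T'" "b < dim_col T'"
    then show "T $$ (a, b) = T' $$ (a, b)"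
      using entry[of "dim_row C + dim_row M + a" "dim_col C + dim_col M + b"] dims
      by (simp add: canonical_block_index)
  qed (use dims in auto)
qed

lemma (in proximity) canonical_formE:
  assumes "canonical_form k r y P C M ThC ThM Th"
  obtains cs ms os where "ordered_proximity k n r y cs ms os" "P = order_mat (cs @ ms @ os)"
    "C = mat_select A cs cs" "M = mat_select A ms ms" "Th = mat_select A os os"
    "ThC = mat_select A os cs" "ThM = mat_select A os ms"
proof -
  from assms obtain cs ms :: "nat list list" and ws :: "nat list list list" where
    order: "distinct (concat cs @ concat ms @ concat (concat ws))"
      "set (concat cs @ concat ms @ concat (concat ws)) = {..<n}"
    and sets: "set ` set cs = verts ` closed_minded G" "set ` set ms = verts ` moderate_minded G"
    and P: "P = order_mat (concat cs @ concat ms @ concat (concat ws))"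
    and C: "C = diag_block_mat (map (\<lambda>l. mat_select A l l) cs)"
    and M: "M = diag_block_mat (map (\<lambda>l. mat_select A l l) ms)"
    and Th: "Th = diag_block_mat (map (\<lambda>W. mat_select A (concat W) (concat W)) ws)"
    and ThC: "ThC = mat_select A (concat (concat ws)) (concat cs)"
    and ThM: "ThM = mat_select A (concat (concat ws)) (concat ms)"
    and eq: "P * A * transpose_mat P = canonical_block C M ThC ThM Th"
    unfolding canonical_form_def Let_def dim_y by blast
  let ?c = "concat cs" and ?m = "concat ms" and ?o = "concat (concat ws)"
  interpret o: ordered_proximity k n r y ?c ?m ?o
  proof
    show "set ?c = \<Union> (verts ` closed_minded G)" "set ?m = \<Union> (verts ` moderate_minded G)"
      unfolding sets[symmetric] by auto
  qed (fact order)+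
  have dims: "dim_row C = length ?c" "dim_col C = length ?c" "dim_row M = length ?m" "dim_col M = length ?m"
    unfolding C M dim_diag_block_mat by (simp_all add: length_concat comp_def)
  have "length ?o = (\<Sum>W\<leftarrow>ws. length (concat W))" by (induction ws) simp_all
  then have "dim_row Th = length ?o" "dim_col Th = length ?o"
    unfolding Th dim_diag_block_mat by (simp_all add: comp_def)
  note dims = dims this
  have "canonical_block C M ThC ThM Th = mat_select A (?c @ ?m @ ?o) (?c @ ?m @ ?o)"
    using eq order_mat_conj[OF A_carrier order] unfolding P by simp
  also have "\<dots> = canonical_block (mat_select A ?c ?c) (mat_select A ?m ?m) ThC ThM (mat_select A ?o ?o)"
    unfolding ThC ThM by (rule o.A_canonical_block)
  finally have "C = mat_select A ?c ?c" "M = mat_select A ?m ?m" "Th = mat_select A ?o ?o"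
    by (rule canonical_block_inject; simp only: dims ThC ThM mat_select_dim)+
  then show ?thesis using that o.ordered_proximity_axioms P ThC ThM by blast
qed

lemma same_topology_adj_mat:
  assumes "dim_vec y = dim_vec z" "prox_digraph k r y = prox_digraph k r z"
  shows "adj_mat k r y = adj_mat k r z"
proof -
  have "out_nbrs k r y i = out_nbrs k r z i" if "i < dim_vec z" for i
  proof -
    have "out_nbrs k r x i = {j. (i, j) \<in> arcs (prox_digraph k r x)}" if "i < dim_vec x" for x
      using that by (simp add: prox_digraph_def)
    then show ?thesis using assms that by metis
  qed
  then show ?thesis unfolding adj_mat_def assms(1) by (intro cong_mat) auto
qed

theorem proposition3p2:
  fixes k :: bounded_model and n :: nat and r y :: "real vec"
    and P C M ThC ThM Th :: "real mat"
  assumes y: "y \<in> carrier_vec n"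
    and r: "r \<in> carrier_vec n" "\<forall>i<n. 0 < r $ i"
    and canon: "canonical_form k r y P C M ThC ThM Th"
  defines "G \<equiv> prox_digraph k r"
    and "z \<equiv> fvct k r y"
    and "Mstar \<equiv> mat_lim (\<lambda>t. M ^\<^sub>m t)"
    and "R \<equiv> the (mat_inverse (1\<^sub>m (dim_row Th) - Th))"
  shows "vec_convergent (fvct_seq k r y)
       \<and> mat_convergent (\<lambda>t. M ^\<^sub>m t)
       \<and> invertible_mat (1\<^sub>m (dim_row Th) - Th)
       \<and> z = (transpose_mat P
              * canonical_block C Mstar (R * ThC * C) (R * ThM * Mstar)
                  (0\<^sub>m (dim_row Th) (dim_row Th))
              * P) *\<^sub>v y
       \<and> (G y = G z \<longrightarrow>
            equilibrium k r z
          \<and> moderate_minded (G y) = {}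
          \<and> (\<forall>W\<in>wccs (G z). \<forall>i\<in>verts W.
               z $ i = Max ((\<lambda>j. z $ j) ` verts W) \<or> z $ i = Min ((\<lambda>j. z $ j) ` verts W)
               \<longrightarrow> (\<exists>H\<in>closed_minded (G z). verts H \<subseteq> verts W \<and> i \<in> verts H)))"
proof -
  interpret Y: proximity k n r y
    by unfold_locales (use y r in auto)
  obtain cs ms os where ord: "ordered_proximity k n r y cs ms os"
    and P: "P = order_mat (cs @ ms @ os)"
    and blocks: "C = mat_select Y.A cs cs" "M = mat_select Y.A ms ms" "Th = mat_select Y.A os os"
      "ThC = mat_select Y.A os cs" "ThM = mat_select Y.A os ms"
    using Y.canonical_formE[OF canon] by metis
  interpret O: ordered_proximity k n r y cs ms os by (rule ord)
  have dim_Th: "dim_row Th = length os" by (simp add: blocks)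
  have Mstar: "Mstar = mat_select Y.A_lim ms ms"
    unfolding Mstar_def blocks by (rule mat_lim_eqI[OF O.M_pow_tendsto])
  have A_lim: "Y.A_lim = transpose_mat P * canonical_block C Mstar (R * ThC * C) (R * ThM * Mstar)
      (0\<^sub>m (dim_row Th) (dim_row Th)) * P"
    using O.A_lim_conjugate unfolding O.A_lim_canonical_block O.open_block_invertible
    unfolding P R_def dim_Th Mstar blocks mat_select_dim .
  interpret Z: proximity k n r z
    by unfold_locales (use Y.A_lim_carrier Y.bounds_pos in \<open>auto simp: z_def Y.fvct_eq\<close>)
  have equilibrium: "equilibrium k r z" if "G y = G z"
  proof -
    have "adj_mat k r z = Y.A"
      using same_topology_adj_mat[of z y k r] that Y.dim_y Z.dim_y by (simp add: G_def)
    then show ?thesis using Y.A_mult_fvct by (simp add: equilibrium_def z_def)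
  qed
  show ?thesis
  proof (intro conjI impI ballI)
    show "vec_convergent (fvct_seq k r y)"
      unfolding vec_convergent_def using Y.fvct_seq_tendsto by blast
    show "mat_convergent (\<lambda>t. M ^\<^sub>m t)"
      unfolding mat_convergent_def blocks using O.M_pow_tendsto by blast
    show "invertible_mat (1\<^sub>m (dim_row Th) - Th)"
      unfolding dim_Th unfolding blocks by (rule O.open_block_invertible)
    show "z = (transpose_mat P * canonical_block C Mstar (R * ThC * C) (R * ThM * Mstar)
        (0\<^sub>m (dim_row Th) (dim_row Th)) * P) *\<^sub>v y"
      unfolding A_lim[symmetric] z_def by (rule Y.fvct_eq)
  next
    assume "G y = G z"
    then show "equilibrium k r z" by (rule equilibrium)
    then show "moderate_minded (G y) = {}"
      using Z.equilibrium_no_moderate_minded \<open>G y = G z\<close> by (simp add: G_def)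
  next
    fix W i assume "G y = G z" "W \<in> wccs (G z)" "i \<in> verts W"
      and "z $ i = Max ((\<lambda>j. z $ j) ` verts W) \<or> z $ i = Min ((\<lambda>j. z $ j) ` verts W)"
    then show "\<exists>H\<in>closed_minded (G z). verts H \<subseteq> verts W \<and> i \<in> verts H"
      using Z.equilibrium_extremum_closed_minded equilibrium unfolding G_def by blast
  qed
qed

end
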